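(* Let $G=(V,E)$ be a simple graph with $n$ vertices, given as an edge stream, and let $\epsilon>0$ and $\delta\in(0,1)$. Consider the following algorithm. Set $\prec$ to be an empty list, $U\gets V$, $\hat\epsilon\gets\frac{\epsilon}{4+3\epsilon}$, $\Delta\gets n-1$, $K\gets 1+\epsilon$, $T\gets\log_{1+\epsilon/2}n$. While $U\neq\emptyset$: (1) using one pass over the edge list, build a directed graph $\tilde G$ on $U$ by including each of the two directions of each edge of $G[U]$ independently with probability $p=\min\{\frac{3K}{\hat\epsilon^2\Delta}\ln\frac{2nT}{\delta},1\}$; (2) set $\beta\gets\frac{3\epsilon}{4}$ and $H\gets U$, and for each $v\in U$ in an arbitrary order, compute $\hat d(v)=\frac1p\cdot(\text{out-degree of } v \text{ in } \tilde G[H])$ and, if $\hat d(v)\ge\frac{\Delta}{1+\beta}$, append $v$ to $\prec$ and set $H\gets H\setminus\{v\}$; then set $U\gets H$; (3) set $\Delta\gets\frac{\Delta}{1+\epsilon/2}$. Finally return $\prec$. Then, with probability at least $1-\delta$, this algorithm returns a $\frac{1}{1+\epsilon}$-DD order of $G$ using $O\!\left(\frac{\log n}{\epsilon}\right)$ passes and $O\!\left(\frac{n}{\epsilon^2}\log\frac{n}{\epsilon\delta}\right)$ words of memory.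
   Context: Streaming model: the edges of $G$ can only be read by sequential scans ("passes") of the edge list, in an arbitrary order; memory is measured in words of $O(\log n)$ bits. For $U\subseteq V$, $G[U]$ is the induced subgraph. For a total order $\prec$ on $V$ and $v\in V$, $G(v)=G[\{u: v\preceq u\}]$, and $d(u\mid G(v))$ is the degree of $u$ in $G(v)$. For $\vartheta>0$, a $\vartheta$-DD order is a total order $\prec$ on $V$ such that for all $v\in V$ with $d(v\mid G(v))\ge1$ and all $u\succeq v$, $d(v\mid G(v))\ge\vartheta\, d(u\mid G(v))$. (The list $\prec$ produced by the algorithm is read as a total order, earlier elements being smaller.)
   Formalization: As printed the loop never ends for n≥2 (the last vertex has out-degree 0 but Δ>0), so step (2) also appends v when Δ<1. The O-bounds, false for unbounded ε or n=1, are proved for ε≤ε₀ (constant depending on ε₀) and n≥max(2,2ε); the DD-order claim holds for all ε and n. *)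

theory Defs
  imports "HOL-Probability.Probability"
begin

section \<open>Graphs and DD orders\<close>

definition simple_graph :: "'a set \<Rightarrow> 'a set set \<Rightarrow> bool" where
  "simple_graph V E \<longleftrightarrow> finite V \<and> (\<forall>e\<in>E. e \<subseteq> V \<and> card e = 2)"

definition induced_edges :: "'a set set \<Rightarrow> 'a set \<Rightarrow> 'a set set" where
  "induced_edges E W = {e \<in> E. e \<subseteq> W}"

definition degree_in :: "'a set set \<Rightarrow> 'a \<Rightarrow> nat" where
  "degree_in E v = card {e \<in> E. v \<in> e}"

text \<open>A total order is given by its reflexive relation: \<open>(u, v) \<in> r\<close> means that \<open>u\<close> precedes or
  equals \<open>v\<close>. The graph $G(v)$ is induced by \<open>r `` {v}\<close>, the vertices from \<open>v\<close> on.\<close>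

definition upper_edges :: "'a set set \<Rightarrow> 'a rel \<Rightarrow> 'a \<Rightarrow> 'a set set" where
  "upper_edges E r v = induced_edges E (r `` {v})"

definition dd_order :: "real \<Rightarrow> 'a set \<Rightarrow> 'a set set \<Rightarrow> 'a rel \<Rightarrow> bool" where
  "dd_order \<theta> V E r \<longleftrightarrow> linear_order_on V r \<and>
     (\<forall>v\<in>V. degree_in (upper_edges E r v) v \<ge> 1 \<longrightarrow>
        (\<forall>u\<in>V. (v, u) \<in> r \<longrightarrow>
           real (degree_in (upper_edges E r v) v) \<ge> \<theta> * real (degree_in (upper_edges E r v) u)))"

definition list_order :: "'a list \<Rightarrow> 'a rel" where
  "list_order xs = {(xs ! i, xs ! j) | i j. i \<le> j \<and> j < length xs}"

section \<open>Edge streams and the memory of the algorithm\<close>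

text \<open>Each edge occurs exactly once in the stream, with its endpoints listed in either order.\<close>

definition edge_stream :: "'a set set \<Rightarrow> ('a \<times> 'a) list \<Rightarrow> bool" where
  "edge_stream E es \<longleftrightarrow>
     distinct (map (\<lambda>(u, v). {u, v}) es) \<and> set (map (\<lambda>(u, v). {u, v}) es) = E"

text \<open>The fields \<open>out\<close>, \<open>alive\<close>, \<open>pool\<close>, \<open>arcs\<close> and \<open>dmax\<close> are the list $\prec$, the sets $U$ and $H$,
  the arc set of the sampled digraph and the number $\Delta$. The fields \<open>passes\<close> and \<open>peak\<close> only
  record the resources used (passes so far, largest number of words held so far); they are not part
  of the memory.\<close>

record 'a state =
  out :: "'a list"
  alive :: "'a set"
  pool :: "'a set"
  arcs :: "('a \<times> 'a) set"
  dmax :: real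
  passes :: nat
  peak :: nat

text \<open>A vertex takes one word, an arc two. The 13 further words are for $n$, $\epsilon$, $\delta$,
  $\hat\epsilon$, $\Delta$, $K$, $T$, $\beta$, $p$, the vertex being processed with its estimate
  $\hat d$, and the two endpoints of the edge being read.\<close>

definition words :: "'a state \<Rightarrow> nat" where
  "words s = length (out s) + card (alive s) + card (pool s) + 2 * card (arcs s) + 13"

definition track_peak :: "'a state \<Rightarrow> 'a state" where
  "track_peak s = s\<lparr>peak := max (peak s) (words s)\<rparr>"

section \<open>The algorithm\<close>

definition sample_prob :: "real \<Rightarrow> real \<Rightarrow> nat \<Rightarrow> real \<Rightarrow> real" where
  "sample_prob \<epsilon> \<delta> n \<Delta> =
     (let \<epsilon>' = \<epsilon> / (4 + 3 * \<epsilon>); K = 1 + \<epsilon>; T = log (1 + \<epsilon> / 2) (real n)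
      in min (3 * K / (\<epsilon>'\<^sup>2 * \<Delta>) * ln (2 * real n * T / \<delta>)) 1)"

text \<open>Reading one edge: if both endpoints are in $U$, one independent coin per direction. (For
  very large \<open>\<epsilon>\<close> the formula for \<open>p\<close> can be negative; \<^const>\<open>bernoulli_pmf\<close> then uses 0.)\<close>

definition read_edge :: "real \<Rightarrow> 'a \<times> 'a \<Rightarrow> 'a state \<Rightarrow> 'a state pmf" where
  "read_edge p e s = (case e of (u, v) \<Rightarrow>
     if u \<in> alive s \<and> v \<in> alive s then
       bind_pmf (bernoulli_pmf p) (\<lambda>b.
       bind_pmf (bernoulli_pmf p) (\<lambda>c.
         return_pmf (track_peak (s\<lparr>arcs := arcs s \<union> (if b then {(u, v)} else {})
                                             \<union> (if c then {(v, u)} else {})\<rparr>))))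
     else return_pmf s)"

primrec scan :: "real \<Rightarrow> ('a \<times> 'a) list \<Rightarrow> 'a state \<Rightarrow> 'a state pmf" where
  "scan p [] s = return_pmf s"
| "scan p (e # es) s = bind_pmf (read_edge p e s) (scan p es)"

definition estimate :: "real \<Rightarrow> 'a state \<Rightarrow> 'a \<Rightarrow> real" where
  "estimate p s v = 1 / p * real (card {w \<in> pool s. (v, w) \<in> arcs s})"

text \<open>Since $\Delta$ stays positive (when $n \ge 2$), the bare test $\hat d(v) \ge \Delta/(1+\beta)$
  never succeeds for a vertex of out-degree 0; in particular the last vertex of $H$ would never be
  removed and the loop would not end. As $\Delta$ plays the role of an upper bound for the (integer)
  degrees in $G[U]$, the remaining vertices are accepted once $\Delta < 1$.\<close>

definition visit :: "real \<Rightarrow> real \<Rightarrow> 'a \<Rightarrow> 'a state \<Rightarrow> 'a state" where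
  "visit \<epsilon> p v s =
     (let \<beta> = 3 * \<epsilon> / 4 in
      if estimate p s v \<ge> dmax s / (1 + \<beta>) \<or> dmax s < 1
      then track_peak (s\<lparr>out := out s @ [v], pool := pool s - {v}\<rparr>)
      else s)"

text \<open>One iteration of the loop. The list \<open>es k\<close> is the edge list as read in the pass with index \<open>k\<close>
  (the first pass has index 0). The function \<open>enum\<close> supplies the arbitrary order in which the
  vertices of $U$ are visited; it may depend on everything that happened before the iteration, but
  not on the coins of the current pass.\<close>

definition iteration ::
  "real \<Rightarrow> real \<Rightarrow> nat \<Rightarrow> (nat \<Rightarrow> ('a \<times> 'a) list) \<Rightarrow> ('a state \<Rightarrow> 'a list) \<Rightarrow> 'a state \<Rightarrow> 'a state pmf"
where
  "iteration \<epsilon> \<delta> n es enum s =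
     (let p = sample_prob \<epsilon> \<delta> n (dmax s) in
      bind_pmf (scan p (es (passes s)) (track_peak (s\<lparr>arcs := {}, passes := passes s + 1\<rparr>))) (\<lambda>s1.
        let s2 = track_peak (s1\<lparr>pool := alive s1\<rparr>);
            s3 = fold (visit \<epsilon> p) (enum s) s2
        in return_pmf (s3\<lparr>alive := pool s3, dmax := dmax s3 / (1 + \<epsilon> / 2)\<rparr>)))"

text \<open>The while loop. The result is a subprobability mass function: runs that do not terminate
  contribute no mass.\<close>

partial_function (spmf) while_loop ::
  "real \<Rightarrow> real \<Rightarrow> nat \<Rightarrow> (nat \<Rightarrow> ('a \<times> 'a) list) \<Rightarrow> ('a state \<Rightarrow> 'a list) \<Rightarrow> 'a state \<Rightarrow> 'a state spmf"
where
  "while_loop \<epsilon> \<delta> n es enum s =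
     (if alive s = {} then return_spmf s
      else bind_spmf (spmf_of_pmf (iteration \<epsilon> \<delta> n es enum s)) (while_loop \<epsilon> \<delta> n es enum))"

definition initial_state :: "'a set \<Rightarrow> 'a state" where
  "initial_state V = track_peak \<lparr>out = [], alive = V, pool = {}, arcs = {},
     dmax = real (card V) - 1, passes = 0, peak = 0\<rparr>"

definition dd_algorithm ::
  "real \<Rightarrow> real \<Rightarrow> 'a set \<Rightarrow> (nat \<Rightarrow> ('a \<times> 'a) list) \<Rightarrow> ('a state \<Rightarrow> 'a list) \<Rightarrow> 'a state spmf" where
  "dd_algorithm \<epsilon> \<delta> V es enum = while_loop \<epsilon> \<delta> (card V) es enum (initial_state V)"

definition valid_enum :: "('a state \<Rightarrow> 'a list) \<Rightarrow> bool" where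
  "valid_enum enum \<longleftrightarrow>
     (\<forall>s. finite (alive s) \<longrightarrow> distinct (enum s) \<and> set (enum s) = alive s)"

end

theory Submission
  imports Defs
begin

text \<open>Let \<open>b = 1 + \<epsilon> / 2\<close> and \<open>T = log b n\<close>. As long as all estimates are accurate, every degree in
  $G[U]$ is at most $\Delta$ at the start of a round: an accepted vertex has degree at least
  $\Delta/(1+\epsilon)$ in $G[H]$, hence satisfies the DD condition, and a rejected one has degree at
  most \<open>\<Delta> / b\<close>. Depending on its degree, a vertex can be misjudged in at most one direction, so a
  one-sided Chernoff bound gives failure probability at most $\delta/(2nT)$ per vertex, that is
  $\delta/(2T)$ per round. The other half of $\delta$ pays for the event that some round samples more
  than three times the bound on the mean number of arcs. Rounds with \<open>p = 1\<close> cannot fail, and at most \<open>T\<close>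
  rounds have \<open>p < 1\<close>. If \<open>T < 1\<close>, then \<open>n < b\<close> and every order is a DD order.\<close>

section \<open>Binomial tails\<close>

text \<open>The threshold \<open>\<Delta> / (1 + \<beta>)\<close> equals both
  \<open>(1 + \<epsilon>') * \<Delta> / (1 + \<epsilon>)\<close> and
  \<open>(1 - \<epsilon>') * \<Delta> / (1 + \<epsilon> / 2)\<close> for
  \<open>\<epsilon>' = \<epsilon> / (4 + 3 * \<epsilon>)\<close>; this is the origin of \<epsilon>'.
  The smaller critical mean, \<open>p * \<Delta> / (1 + \<epsilon>)\<close>, equals
  \<open>3 * L / \<epsilon>'\<^sup>2\<close> when \<open>p < 1\<close>, which makes the Chernoff
  exponent \<open>L = ln (2 * n * T / \<delta>)\<close>. The obstacle is adaptivity: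
  \<open>H\<close> depends on coins already inspected. The two directions of an edge have separate
  coins, and a vertex looks only at its outgoing ones. To exploit this, a sweep is described as a
  function of a coin assignment on arcs, apart from the program state, and the scan is shown to
  produce such independent coins. Termination and the schedule of \<Delta> hold for all coins, while
  the degree bounds, the DD property and the memory bound hold only with high probability; hence
  there are two invariants.\<close>

lemma expectation_exp_binomial_le:
  fixes p r :: real
  assumes "0 \<le> p" "p \<le> 1"
  shows "measure_pmf.expectation (binomial_pmf n p) (\<lambda>k. exp (r * real k))
           \<le> exp (real n * p * (exp r - 1))"
proof -
  have "measure_pmf.expectation (binomial_pmf n p) (\<lambda>k. exp (r * real k))
      = (\<Sum>k\<le>n. real (n choose k) * p ^ k * (1 - p) ^ (n - k) * exp (r * real k))"
    using assms by (subst expectation_binomial_pmf') auto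
  also have "\<dots> = (\<Sum>k\<le>n. real (n choose k) * (p * exp r) ^ k * (1 - p) ^ (n - k))"
    by (intro sum.cong) (auto simp: power_mult_distrib exp_of_nat2_mult mult_ac)
  also have "\<dots> = (p * exp r + (1 - p)) ^ n"
    by (simp add: binomial_ring)
  also have "\<dots> \<le> exp (p * (exp r - 1)) ^ n"
  proof (rule power_mono)
    show "p * exp r + (1 - p) \<le> exp (p * (exp r - 1))"
      using exp_ge_add_one_self[of "p * (exp r - 1)"] by (simp add: algebra_simps)
  qed (use assms in auto)
  also have "\<dots> = exp (real n * p * (exp r - 1))"
    by (simp add: exp_of_nat_mult[symmetric] mult_ac)
  finally show ?thesis .
qed

text \<open>Markov's inequality for \<open>exp (r * k)\<close>. The sign of \<open>r\<close> is left
  open, so that upper tails (\<open>r > 0\<close>) and lower tails (\<open>r < 0\<close>) are both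
  instances.\<close>

lemma binomial_exp_markov:
  fixes p r t :: real
  assumes "0 \<le> p" "p \<le> 1" and "\<And>k. P k \<Longrightarrow> t \<le> r * real k"
  shows "measure_pmf.prob (binomial_pmf n p) {k. P k} \<le> exp (real n * p * (exp r - 1) - t)"
proof -
  let ?M = "binomial_pmf n p"
  have fin: "finite (set_pmf ?M)"
    by (rule finite_subset[of _ "{..n}"]) (use assms set_pmf_binomial_eq[of p n] in auto)
  have int: "integrable ?M f" for f :: "nat \<Rightarrow> real"
    using fin by (rule integrable_measure_pmf_finite)
  have "measure_pmf.prob ?M {k. P k} = measure_pmf.expectation ?M (indicator {k. P k})"
    by simp
  also have "\<dots> \<le> measure_pmf.expectation ?M (\<lambda>k. exp (r * real k) * exp (- t))"
    using assms(3) by (intro integral_mono int) (auto simp: indicator_def simp flip: exp_add)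
  also have "\<dots> = measure_pmf.expectation ?M (\<lambda>k. exp (r * real k)) * exp (- t)"
    by simp
  also have "\<dots> \<le> exp (real n * p * (exp r - 1)) * exp (- t)"
    using expectation_exp_binomial_le[OF assms(1,2)] by (intro mult_right_mono) auto
  finally show ?thesis
    by (metis exp_add diff_conv_add_uminus)
qed

lemma ln_one_plus_ge_quadratic:
  fixes x :: real
  assumes "0 \<le> x"
  shows "x - x\<^sup>2 / 2 \<le> ln (1 + x)"
proof -
  let ?f = "\<lambda>x::real. ln (1 + x) - x + x\<^sup>2 / 2"
  have "?f 0 \<le> ?f x"
  proof (rule DERIV_nonneg_imp_nondecreasing[OF assms])
    fix y :: real assume "0 \<le> y" "y \<le> x"
    then have "(?f has_real_derivative 1 / (1 + y) - 1 + y) (at y)"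
      by (auto intro!: derivative_eq_intros)
    moreover have "1 / (1 + y) - 1 + y = y\<^sup>2 / (1 + y)"
      using \<open>0 \<le> y\<close> by (simp add: field_simps power2_eq_square)
    ultimately show "\<exists>d. (?f has_real_derivative d) (at y) \<and> 0 \<le> d"
      using \<open>0 \<le> y\<close> by (intro exI[of _ "y\<^sup>2 / (1 + y)"]) auto
  qed
  then show ?thesis by simp
qed

lemma exp_minus_le_quadratic:
  fixes x :: real
  assumes "0 \<le> x"
  shows "exp (- x) \<le> 1 - x + x\<^sup>2 / 2"
proof -
  let ?f = "\<lambda>x::real. 1 - x + x\<^sup>2 / 2 - exp (- x)"
  have "?f 0 \<le> ?f x"
  proof (rule DERIV_nonneg_imp_nondecreasing[OF assms])
    fix y :: real assume "0 \<le> y" "y \<le> x"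
    have "(?f has_real_derivative - 1 + y + exp (- y)) (at y)"
      by (auto intro!: derivative_eq_intros)
    moreover have "0 \<le> - 1 + y + exp (- y)"
      using exp_ge_add_one_self[of "- y"] by linarith
    ultimately show "\<exists>d. (?f has_real_derivative d) (at y) \<and> 0 \<le> d"
      by blast
  qed
  then show ?thesis by simp
qed

text \<open>Taken with \<open>r = ln (1 + \<eta>)\<close>. Since \<open>\<mu>\<close> only has to
  dominate the mean, all degrees below the critical one are covered. The bound
  \<open>ln (1 + \<eta>) \<ge> \<eta> - \<eta>\<^sup>2 / 2\<close> leaves the remainder
  \<open>\<eta>\<^sup>2 * \<mu> / 2 * (1/3 - \<eta>)\<close>, which is why
  \<open>\<eta> \<le> 1/3\<close> is asked for; \<epsilon>' always meets this.\<close>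

lemma chernoff_upper:
  fixes p \<eta> \<mu> :: real
  assumes p: "0 \<le> p" "p \<le> 1" and \<eta>: "0 \<le> \<eta>" "\<eta> \<le> 1/3" and \<mu>: "real n * p \<le> \<mu>"
  shows "measure_pmf.prob (binomial_pmf n p) {k. (1 + \<eta>) * \<mu> \<le> real k} \<le> exp (- \<eta>\<^sup>2 * \<mu> / 3)"
proof -
  have \<mu>0: "0 \<le> \<mu>" using p \<mu> by (meson mult_nonneg_nonneg of_nat_0_le_iff order_trans)
  define t where "t = ln (1 + \<eta>) * ((1 + \<eta>) * \<mu>)"
  have "measure_pmf.prob (binomial_pmf n p) {k. (1 + \<eta>) * \<mu> \<le> real k}
        \<le> exp (real n * p * (exp (ln (1 + \<eta>)) - 1) - t)"
    unfolding t_def using p \<eta> by (intro binomial_exp_markov mult_left_mono) auto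
  also have "\<dots> \<le> exp (- \<eta>\<^sup>2 * \<mu> / 3)"
  proof -
    have "real n * p * \<eta> \<le> \<mu> * \<eta>"
      using \<mu> \<eta> by (intro mult_right_mono) auto
    moreover have "(\<eta> - \<eta>\<^sup>2 / 2) * ((1 + \<eta>) * \<mu>) \<le> t"
      unfolding t_def using ln_one_plus_ge_quadratic[OF \<eta>(1)] \<mu>0 \<eta>
      by (intro mult_right_mono) auto
    moreover have "(\<eta> - \<eta>\<^sup>2 / 2) * ((1 + \<eta>) * \<mu>) - \<mu> * \<eta> - \<eta>\<^sup>2 * \<mu> / 3 = \<eta>\<^sup>2 * \<mu> / 2 * (1/3 - \<eta>)"
      by (simp add: field_simps power2_eq_square)
    moreover have "0 \<le> \<eta>\<^sup>2 * \<mu> / 2 * (1/3 - \<eta>)"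
      using \<mu>0 \<eta> by simp
    ultimately have "real n * p * \<eta> - t \<le> - \<eta>\<^sup>2 * \<mu> / 3" by simp
    then show ?thesis using \<eta> by simp
  qed
  finally show ?thesis .
qed

text \<open>The choice \<open>r = - \<eta>\<close> instead of the optimal
  \<open>ln (1 - \<eta>)\<close> suffices: with
  \<open>exp (- \<eta>) - 1 \<le> - \<eta> + \<eta>\<^sup>2 / 2\<close> the terms add up to exactly
  \<open>- \<eta>\<^sup>2 * \<mu> / 2\<close>.\<close>

lemma chernoff_lower:
  fixes p \<eta> \<mu> :: real
  assumes p: "0 \<le> p" "p \<le> 1" and \<eta>: "0 \<le> \<eta>" and \<mu>: "0 \<le> \<mu>" "\<mu> \<le> real n * p"
  shows "measure_pmf.prob (binomial_pmf n p) {k. real k \<le> (1 - \<eta>) * \<mu>} \<le> exp (- \<eta>\<^sup>2 * \<mu> / 2)"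
proof -
  have "measure_pmf.prob (binomial_pmf n p) {k. real k \<le> (1 - \<eta>) * \<mu>}
        \<le> exp (real n * p * (exp (- \<eta>) - 1) - (- \<eta> * ((1 - \<eta>) * \<mu>)))"
    using p \<eta> by (intro binomial_exp_markov mult_left_mono_neg) auto
  also have "\<dots> \<le> exp (- \<eta>\<^sup>2 * \<mu> / 2)"
  proof -
    have "real n * p * (exp (- \<eta>) - 1) \<le> \<mu> * (exp (- \<eta>) - 1)"
      using \<mu> \<eta> by (intro mult_right_mono_neg) auto
    also have "\<dots> \<le> \<mu> * (- \<eta> + \<eta>\<^sup>2 / 2)"
      using exp_minus_le_quadratic[OF \<eta>] \<mu> by (intro mult_left_mono) auto
    finally show ?thesis by (simp add: field_simps power2_eq_square)
  qed
  finally show ?thesis .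
qed

lemma binomial_large_deviation:
  fixes p \<mu> :: real
  assumes p: "0 \<le> p" "p \<le> 1" and \<mu>: "real n * p \<le> \<mu>"
  shows "measure_pmf.prob (binomial_pmf n p) {k. 3 * \<mu> \<le> real k} \<le> exp (- \<mu>)"
proof -
  have \<mu>0: "0 \<le> \<mu>" using p \<mu> by (meson mult_nonneg_nonneg of_nat_0_le_iff order_trans)
  have "measure_pmf.prob (binomial_pmf n p) {k. 3 * \<mu> \<le> real k}
        \<le> exp (real n * p * (exp 1 - 1) - 3 * \<mu>)"
    using p by (intro binomial_exp_markov) auto
  \<comment> \<open>With \<open>r = 1\<close> and \<open>exp 1 \<le> 3\<close> the exponent is at
    most \<open>2 * \<mu> - 3 * \<mu>\<close>.\<close>
  also have "real n * p * (exp 1 - 1) \<le> \<mu> * 2"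
    using \<mu> \<mu>0 exp_le p by (intro mult_mono) auto
  finally show ?thesis by simp
qed

section \<open>Independent coins and two-stage experiments\<close>

lemma card_Pi_bernoulli:
  assumes "finite D" "S \<subseteq> D" "0 \<le> p" "p \<le> 1"
  shows "map_pmf (\<lambda>\<omega>. card {a\<in>S. \<omega> a}) (Pi_pmf D False (\<lambda>_. bernoulli_pmf p))
       = binomial_pmf (card S) p"
proof -
  have "finite S" using assms finite_subset by blast
  then have "binomial_pmf (card S) p
      = map_pmf (\<lambda>\<omega>. card {a\<in>S. \<omega> a}) (Pi_pmf S False (\<lambda>_. bernoulli_pmf p))"
    using assms by (intro binomial_pmf_altdef') auto
  also have "\<dots> = map_pmf (\<lambda>\<omega>. card {a\<in>S. \<omega> a}) (Pi_pmf D False (\<lambda>_. bernoulli_pmf p))"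
    unfolding Pi_pmf_subset[OF assms(1,2), of False "\<lambda>_. bernoulli_pmf p"] pmf.map_comp
    by (intro map_pmf_cong refl) (auto intro!: arg_cong[of _ _ card])
  finally show ?thesis ..
qed

lemma prob_card_Pi_bernoulli:
  assumes "finite D" "S \<subseteq> D" "0 \<le> p" "p \<le> 1"
  shows "measure_pmf.prob (Pi_pmf D False (\<lambda>_. bernoulli_pmf p)) {\<omega>. P (card {a\<in>S. \<omega> a})}
       = measure_pmf.prob (binomial_pmf (card S) p) {k. P k}"
  by (simp add: vimage_def flip: card_Pi_bernoulli[OF assms])

lemma prob_bind_pmf:
  "measure_pmf.prob (bind_pmf M f) A = measure_pmf.expectation M (\<lambda>x. measure_pmf.prob (f x) A)"
proof -
  have "ennreal (measure_pmf.prob (bind_pmf M f) A) = (\<integral>\<^sup>+x. measure_pmf.prob (f x) A \<partial>M)"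
    unfolding measure_pmf.emeasure_eq_measure[symmetric] by simp
  also have "\<dots> = ennreal (measure_pmf.expectation M (\<lambda>x. measure_pmf.prob (f x) A))"
    by (intro nn_integral_eq_integral measure_pmf.integrable_const_bound[where B = 1]) auto
  finally show ?thesis by (simp add: integral_nonneg)
qed

text \<open>Union bound for a two-stage experiment: outcomes in \<open>B\<close> are charged with
  probability 1, all others with \<open>r\<close>. The second stage may depend on the first.\<close>

lemma prob_bind_pmf_le:
  assumes "0 \<le> r" "\<And>x. x \<in> set_pmf M \<Longrightarrow> x \<notin> B \<Longrightarrow> measure_pmf.prob (f x) A \<le> r"
  shows "measure_pmf.prob (bind_pmf M f) A \<le> measure_pmf.prob M B + r"
proof -
  have ind: "integrable M (indicator B :: _ \<Rightarrow> real)"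
    by (intro measure_pmf.integrable_const_bound[where B = 1]) auto
  have "measure_pmf.prob (bind_pmf M f) A = measure_pmf.expectation M (\<lambda>x. measure_pmf.prob (f x) A)"
    by (rule prob_bind_pmf)
  also have "\<dots> \<le> measure_pmf.expectation M (\<lambda>x. indicator B x + r)"
  proof (rule integral_mono_AE)
    show "AE x in M. measure_pmf.prob (f x) A \<le> indicator B x + r"
      using assms by (auto simp: AE_measure_pmf_iff indicator_def intro: order_trans[OF measure_pmf.prob_le_1])
    have "measure_pmf.prob (f x) A \<le> 1 + r" for x
      using measure_pmf.prob_le_1[of "f x" A] assms(1) by linarith
    then show "integrable M (\<lambda>x. measure_pmf.prob (f x) A)"
      by (intro measure_pmf.integrable_const_bound[where B = "1 + r"]) auto
    show "integrable M (\<lambda>x. indicator B x + r)"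
      using ind by simp
  qed
  also have "\<dots> = measure_pmf.prob M B + r"
    using ind by simp
  finally show ?thesis .
qed

section \<open>Neighbourhoods and sampled arcs\<close>

definition nbrs :: "'a set set \<Rightarrow> 'a set \<Rightarrow> 'a \<Rightarrow> 'a set" where
  "nbrs E H v = {w \<in> H. {v, w} \<in> E}"

definition arcs_in :: "'a set set \<Rightarrow> 'a set \<Rightarrow> ('a \<times> 'a) set" where
  "arcs_in E U = {(u, v). u \<in> U \<and> v \<in> U \<and> {u, v} \<in> E}"

lemma simple_graph_edge_neq: "simple_graph V E \<Longrightarrow> {u, v} \<in> E \<Longrightarrow> u \<noteq> v"
  by (auto simp: simple_graph_def card_insert_if dest!: bspec)

lemma degree_in_induced_edges:
  assumes "simple_graph V E" "v \<in> H"
  shows "degree_in (induced_edges E H) v = card (nbrs E H v)"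
proof -
  have "bij_betw (\<lambda>w. {v, w}) (nbrs E H v) {e \<in> induced_edges E H. v \<in> e}"
  proof (rule bij_betwI')
    show "({v, x} = {v, y}) = (x = y)" for x y by (auto simp: doubleton_eq_iff)
    show "{v, x} \<in> {e \<in> induced_edges E H. v \<in> e}" if "x \<in> nbrs E H v" for x
      using that assms(2) by (auto simp: nbrs_def induced_edges_def)
    show "\<exists>x\<in>nbrs E H v. e = {v, x}" if "e \<in> {e \<in> induced_edges E H. v \<in> e}" for e
    proof -
      from that have e: "e \<in> E" "e \<subseteq> H" "v \<in> e" by (auto simp: induced_edges_def)
      with assms(1) have "card e = 2" by (auto simp: simple_graph_def)
      then obtain x y where "e = {x, y}" by (auto simp: card_2_iff)
      with e(3) obtain w where "e = {v, w}" by (cases "v = x") (auto simp: insert_commute)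
      with e show ?thesis by (auto simp: nbrs_def)
    qed
  qed
  then show ?thesis by (simp add: degree_in_def bij_betw_same_card)
qed

lemma nbrs_mono: "H \<subseteq> U \<Longrightarrow> nbrs E H v \<subseteq> nbrs E U v"
  by (auto simp: nbrs_def)

lemma finite_nbrs: "finite H \<Longrightarrow> finite (nbrs E H v)"
  by (simp add: nbrs_def)

lemma card_nbrs_less:
  assumes "simple_graph V E" "finite H" "v \<in> H"
  shows "card (nbrs E H v) < card H"
proof (rule psubset_card_mono)
  have "v \<notin> nbrs E H v" using simple_graph_edge_neq[OF assms(1), of v v] by (auto simp: nbrs_def)
  then show "nbrs E H v \<subset> H" using assms(3) nbrs_def[of E H v] by blast
qed fact

lemma finite_arcs_in: "finite U \<Longrightarrow> finite (arcs_in E U)"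
  by (rule finite_subset[of _ "U \<times> U"]) (auto simp: arcs_in_def)

lemma arcs_in_Sigma: "arcs_in E U = Sigma U (nbrs E U)"
  by (auto simp: arcs_in_def nbrs_def)

lemma card_arcs_in_le:
  assumes "finite U" "\<And>v. v \<in> U \<Longrightarrow> real (card (nbrs E U v)) \<le> D"
  shows "real (card (arcs_in E U)) \<le> real (card U) * D"
proof -
  have "real (card (arcs_in E U)) = (\<Sum>v\<in>U. real (card (nbrs E U v)))"
    using assms(1) by (simp add: arcs_in_Sigma finite_nbrs)
  also have "\<dots> \<le> real (card U) * D"
    using sum_bounded_above[of U "\<lambda>v. real (card (nbrs E U v))" D] assms(2) by simp
  finally show ?thesis .
qed

section \<open>The distribution of the arcs collected in one pass\<close>

lemma scan_support:
  assumes "s' \<in> set_pmf (scan p es s)" "finite (arcs s)"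
  shows "\<exists>A P. s' = s\<lparr>arcs := A, peak := P\<rparr> \<and> arcs s \<subseteq> A \<and>
           A \<subseteq> arcs s \<union> {(u, v). u \<in> alive s \<and> v \<in> alive s \<and> ((u, v) \<in> set es \<or> (v, u) \<in> set es)} \<and>
           finite A \<and> P \<le> max (peak s) (words s')"
  using assms
proof (induction es arbitrary: s)
  case Nil
  then show ?case by (auto intro!: exI[of _ "arcs s"] exI[of _ "peak s"])
next
  case (Cons e es)
  obtain u v where e: "e = (u, v)" by (cases e)
  from Cons.prems obtain t where t: "t \<in> set_pmf (read_edge p e s)" "s' \<in> set_pmf (scan p es t)"
    by auto
  have "\<exists>A P. t = s\<lparr>arcs := A, peak := P\<rparr> \<and> arcs s \<subseteq> A \<and>
           A \<subseteq> arcs s \<union> {(u, v). u \<in> alive s \<and> v \<in> alive s \<and> ((u, v) \<in> {e} \<or> (v, u) \<in> {e})} \<and>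
           finite A \<and> P \<le> max (peak s) (words t)"
  proof (cases "u \<in> alive s \<and> v \<in> alive s")
    case True
    with t(1) obtain b c where "t = track_peak (s\<lparr>arcs := arcs s \<union> (if b then {(u, v)} else {})
                                             \<union> (if c then {(v, u)} else {})\<rparr>)"
      by (auto simp: read_edge_def e)
    then show ?thesis using True Cons.prems(2) e
      by (intro exI[of _ "arcs t"] exI[of _ "peak t"]) (auto simp: track_peak_def words_def)
  next
    case False
    with t(1) have "t = s" by (auto simp: read_edge_def e)
    then show ?thesis using Cons.prems(2)
      by (intro exI[of _ "arcs s"] exI[of _ "peak s"]) auto
  qed
  then obtain A P where A: "t = s\<lparr>arcs := A, peak := P\<rparr>" "arcs s \<subseteq> A"
    "A \<subseteq> arcs s \<union> {(u, v). u \<in> alive s \<and> v \<in> alive s \<and> ((u, v) \<in> {e} \<or> (v, u) \<in> {e})}"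
    "finite A" "P \<le> max (peak s) (words t)" by blast
  from Cons.IH[OF t(2)] A obtain B Q where B: "s' = t\<lparr>arcs := B, peak := Q\<rparr>" "arcs t \<subseteq> B"
    "B \<subseteq> arcs t \<union> {(u, v). u \<in> alive t \<and> v \<in> alive t \<and> ((u, v) \<in> set es \<or> (v, u) \<in> set es)}"
    "finite B" "Q \<le> max (peak t) (words s')" by auto
  \<comment> \<open>Within a scan only \<open>arcs\<close> and \<open>peak\<close> change and
    \<open>arcs\<close> only grows, so no intermediate word count exceeds the final one.\<close>
  have "words t \<le> words s'"
    using B A by (auto simp: words_def intro!: card_mono)
  then show ?case
    using A B by (intro exI[of _ B] exI[of _ Q]) auto
qed

text \<open>Edges are distinct as unordered pairs and are not loops, so the two directions of an
  edge are two fresh coins. The order of the stream disappears: what is left is one independent coin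
  for each arc inside \<open>alive s\<close>.\<close>

lemma scan_arcs:
  fixes s :: "'a state"
  assumes "distinct (map (\<lambda>(u, v). {u, v}) es)" "\<And>u v. (u, v) \<in> set es \<Longrightarrow> u \<noteq> v"
  shows "map_pmf arcs (scan p es s) = map_pmf (\<lambda>\<omega>. arcs s \<union> {a. \<omega> a})
    (Pi_pmf {(u, v). u \<in> alive s \<and> v \<in> alive s \<and> ((u, v) \<in> set es \<or> (v, u) \<in> set es)}
      False (\<lambda>_. bernoulli_pmf p))"
  using assms
proof (induction es arbitrary: s)
  case Nil
  then show ?case by simp
next
  case (Cons e es)
  obtain u v where e: "e = (u, v)" by (cases e)
  define D where "D es = {(u, v). u \<in> alive s \<and> v \<in> alive s \<and> ((u, v) \<in> set es \<or> (v, u) \<in> set es)}"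
    for es
  have fin: "finite (D es)" for es
    by (rule finite_subset[of _ "set es \<union> (\<lambda>(u, v). (v, u)) ` set es"])
       (auto simp: D_def image_iff Bex_def)
  have IH: "map_pmf arcs (scan p es t) = map_pmf (\<lambda>\<omega>. arcs t \<union> {a. \<omega> a})
    (Pi_pmf (D es) False (\<lambda>_. bernoulli_pmf p))" if "alive t = alive s" for t
    using Cons.IH[of t] Cons.prems that by (simp add: D_def)
  show ?case
  proof (cases "u \<in> alive s \<and> v \<in> alive s")
    case False
    then have "D (e # es) = D es" by (auto simp: D_def e)
    with False IH[of s] show ?thesis by (auto simp: D_def read_edge_def e bind_return_pmf)
  next
    case True
    have uv: "u \<noteq> v" using Cons.prems(2)[of u v] e by simp
    have new: "(u, v) \<notin> set es" "(v, u) \<notin> set es"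
      using Cons.prems(1) by (auto simp: e insert_commute image_iff)
    have D: "D (e # es) = insert (u, v) (insert (v, u) (D es))"
      using True by (auto simp: D_def e)
    have nin: "(u, v) \<notin> insert (v, u) (D es)" "(v, u) \<notin> D es"
      using new uv by (auto simp: D_def)
    have "map_pmf arcs (scan p (e # es) s) =
      bernoulli_pmf p \<bind> (\<lambda>b. bernoulli_pmf p \<bind> (\<lambda>c.
        map_pmf (\<lambda>\<omega>. (arcs s \<union> (if b then {(u, v)} else {}) \<union> (if c then {(v, u)} else {})) \<union> {a. \<omega> a})
         (Pi_pmf (D es) False (\<lambda>_. bernoulli_pmf p))))"
      using True
      by (simp add: read_edge_def e map_bind_pmf bind_assoc_pmf bind_return_pmf IH track_peak_def)
    also have "\<dots> = map_pmf (\<lambda>\<omega>. arcs s \<union> {a. \<omega> a}) (Pi_pmf (D (e # es)) False (\<lambda>_. bernoulli_pmf p))"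
    proof -
      \<comment> \<open>Outside its index set the product takes the default \<open>False\<close>;
        both arcs lie outside \<open>D es\<close>, so the two updates add exactly the arcs chosen by
        \<open>b\<close> and \<open>c\<close>.\<close>
      have *: "arcs s \<union> (if b then {(u, v)} else {}) \<union> (if c then {(v, u)} else {}) \<union> {a. \<omega> a}
          = arcs s \<union> Collect (fun_upd (fun_upd \<omega> (v, u) c) (u, v) b)"
        if "\<omega> \<in> set_pmf (Pi_pmf (D es) False (\<lambda>_. bernoulli_pmf p))" for b c \<omega>
      proof -
        have "\<not> \<omega> (u, v)" "\<not> \<omega> (v, u)"
          using that set_Pi_pmf_subset[OF fin, of es False] nin by auto
        then show ?thesis using uv by (auto split: if_splits)
      qed
      show ?thesis
        unfolding D using fin nin uv
        by (simp add: Pi_pmf_insert pair_pmf_def map_bind_pmf bind_assoc_pmf bind_return_pmf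
              map_pmf_def[of _ "Pi_pmf (D es) False (\<lambda>_. bernoulli_pmf p)"] del: fun_upd_apply)
           (intro bind_pmf_cong refl arg_cong[where f = return_pmf], rule *)
    qed
    finally show ?thesis by (simp add: D_def)
  qed
qed

lemma edge_stream_arcs:
  assumes "edge_stream E es"
  shows "{(u, v). u \<in> U \<and> v \<in> U \<and> ((u, v) \<in> set es \<or> (v, u) \<in> set es)} = arcs_in E U"
proof -
  have E: "E = (\<lambda>(u, v). {u, v}) ` set es" using assms by (simp add: edge_stream_def)
  have "{u, v} \<in> E \<longleftrightarrow> (u, v) \<in> set es \<or> (v, u) \<in> set es" for u v
    unfolding E by (force simp: image_iff doubleton_eq_iff)
  then show ?thesis by (auto simp: arcs_in_def)
qed

section \<open>One sweep over the vertices\<close>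

text \<open>The test of \<open>visit\<close> as a function of a coin assignment
  \<open>\<omega>\<close> instead of the state. Only coins of outgoing arcs of \<open>v\<close>
  occur, which gives the independence used later.\<close>

definition accepts :: "real \<Rightarrow> real \<Rightarrow> real \<Rightarrow> 'a set set \<Rightarrow> 'a set \<Rightarrow> ('a \<times> 'a \<Rightarrow> bool) \<Rightarrow> 'a \<Rightarrow> bool" where
  "accepts \<epsilon> p \<Delta> E H \<omega> v \<longleftrightarrow>
     \<Delta> / (1 + 3 * \<epsilon> / 4) \<le> 1 / p * real (card {w \<in> nbrs E H v. \<omega> (v, w)}) \<or> \<Delta> < 1"

text \<open>Accepting an isolated vertex is harmless, since the DD condition asks nothing of it;
  this happens in the closing round with \<open>\<Delta> < 1\<close>.\<close>

definition correct :: "real \<Rightarrow> real \<Rightarrow> real \<Rightarrow> 'a set set \<Rightarrow> 'a set \<Rightarrow> ('a \<times> 'a \<Rightarrow> bool) \<Rightarrow> 'a \<Rightarrow> bool" where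
  "correct \<epsilon> p \<Delta> E H \<omega> v \<longleftrightarrow>
     (if accepts \<epsilon> p \<Delta> E H \<omega> v then nbrs E H v = {} \<or> \<Delta> / (1 + \<epsilon>) \<le> real (card (nbrs E H v))
      else real (card (nbrs E H v)) \<le> \<Delta> / (1 + \<epsilon> / 2))"

text \<open>\<open>H\<close> evolves by the tests themselves, so soundness concerns only the
  decisions that the run really makes; this avoids a union over all possible
  \<open>H\<close>.\<close>

primrec sound ::
  "real \<Rightarrow> real \<Rightarrow> real \<Rightarrow> 'a set set \<Rightarrow> 'a list \<Rightarrow> 'a set \<Rightarrow> ('a \<times> 'a \<Rightarrow> bool) \<Rightarrow> bool" where
  "sound \<epsilon> p \<Delta> E [] H \<omega> = True"
| "sound \<epsilon> p \<Delta> E (v # vs) H \<omega> =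
     (correct \<epsilon> p \<Delta> E H \<omega> v \<and>
      sound \<epsilon> p \<Delta> E vs (if accepts \<epsilon> p \<Delta> E H \<omega> v then H - {v} else H) \<omega>)"

lemma accepts_cong:
  "(\<And>w. w \<in> nbrs E H v \<Longrightarrow> \<omega> (v, w) = \<omega>' (v, w)) \<Longrightarrow>
   accepts \<epsilon> p \<Delta> E H \<omega> v = accepts \<epsilon> p \<Delta> E H \<omega>' v"
  unfolding accepts_def by (metis (no_types, lifting) Collect_cong)

lemma correct_cong:
  "(\<And>w. w \<in> nbrs E H v \<Longrightarrow> \<omega> (v, w) = \<omega>' (v, w)) \<Longrightarrow>
   correct \<epsilon> p \<Delta> E H \<omega> v = correct \<epsilon> p \<Delta> E H \<omega>' v"
  unfolding correct_def using accepts_cong[of E H v \<omega> \<omega>'] by simp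

lemma sound_cong:
  "(\<And>v w. v \<in> set vs \<Longrightarrow> \<omega> (v, w) = \<omega>' (v, w)) \<Longrightarrow>
   sound \<epsilon> p \<Delta> E vs H \<omega> = sound \<epsilon> p \<Delta> E vs H \<omega>'"
proof (induction vs arbitrary: H)
  case (Cons v vs)
  then show ?case
    using accepts_cong[of E H v \<omega> \<omega>'] correct_cong[of E H v \<omega> \<omega>'] by simp
qed simp

text \<open>The degrees split at \<open>\<Delta> / (1 + \<epsilon>)\<close> and
  \<open>\<Delta> / (1 + \<epsilon> / 2)\<close>: below, only an upper tail can hurt, above, only a
  lower tail, and in between both answers are correct. For \<open>p = 1\<close> the estimate is the
  degree itself and the threshold lies between the two bounds.\<close>

lemma incorrect_prob:
  fixes \<epsilon> \<Delta> L :: real and v :: 'a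
  defines "\<epsilon>' \<equiv> \<epsilon> / (4 + 3 * \<epsilon>)"
  defines "p \<equiv> min (3 * (1 + \<epsilon>) / (\<epsilon>'\<^sup>2 * \<Delta>) * L) 1"
  assumes "0 < \<epsilon>" "0 < L" "0 < \<Delta>"
    and D: "finite D" "Pair v ` nbrs E H v \<subseteq> D"
    and small: "\<Delta> < 1 \<Longrightarrow> nbrs E H v = {}"
  shows "measure_pmf.prob (Pi_pmf D False (\<lambda>_. bernoulli_pmf p)) {\<omega>. \<not> correct \<epsilon> p \<Delta> E H \<omega> v}
       \<le> (if p < 1 then exp (- L) else 0)"
proof (cases "\<Delta> < 1")
  case True
  then show ?thesis using small by (simp add: correct_def accepts_def)
next
  case False
  define S where "S = Pair v ` nbrs E H v"
  define d where "d = card (nbrs E H v)"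
  have card_S: "card S = d" unfolding S_def d_def by (rule card_image) (auto simp: inj_on_def)
  have \<epsilon>': "0 < \<epsilon>'" "\<epsilon>' \<le> 1/3" using \<open>0 < \<epsilon>\<close> by (auto simp: \<epsilon>'_def field_simps)
  have p: "0 < p" "p \<le> 1" using assms \<epsilon>' by (auto simp: p_def)
  \<comment> \<open>\<open>wrong\<close> sees the coins only through the number \<open>k\<close> of
    outgoing arcs and forgets the exemption of isolated vertices; this enlarges the event but makes
    it binomial.\<close>
  define wrong where "wrong k \<longleftrightarrow>
     (if p * \<Delta> / (1 + 3 * \<epsilon> / 4) \<le> real k then real d < \<Delta> / (1 + \<epsilon>) else real d > \<Delta> / (1 + \<epsilon> / 2))" for k
  have count: "card {w \<in> nbrs E H v. \<omega> (v, w)} = card {a\<in>S. \<omega> a}" for \<omega>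
  proof -
    have "{a\<in>S. \<omega> a} = Pair v ` {w \<in> nbrs E H v. \<omega> (v, w)}" by (auto simp: S_def)
    then show ?thesis by (simp add: card_image inj_on_def)
  qed
  have "\<not> correct \<epsilon> p \<Delta> E H \<omega> v \<Longrightarrow> wrong (card {a\<in>S. \<omega> a})" for \<omega>
    using False p \<open>0 < \<epsilon>\<close>
    by (auto simp: correct_def accepts_def wrong_def count d_def field_simps split: if_splits)
  then have "measure_pmf.prob (Pi_pmf D False (\<lambda>_. bernoulli_pmf p)) {\<omega>. \<not> correct \<epsilon> p \<Delta> E H \<omega> v}
       \<le> measure_pmf.prob (Pi_pmf D False (\<lambda>_. bernoulli_pmf p)) {\<omega>. wrong (card {a\<in>S. \<omega> a})}"
    by (intro measure_pmf.finite_measure_mono) auto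
  also have "\<dots> = measure_pmf.prob (binomial_pmf d p) {k. wrong k}"
    using prob_card_Pi_bernoulli[OF D(1), of S p wrong] D(2) p by (simp add: S_def[symmetric] card_S)
  also have "\<dots> \<le> (if p < 1 then exp (- L) else 0)"
  proof (cases "p < 1")
    case False
    then have p1: "p = 1" using p by simp
    have "\<not> wrong d"
    proof -
      have "\<Delta> / (1 + \<epsilon>) \<le> \<Delta> / (1 + 3 * \<epsilon> / 4)" "\<Delta> / (1 + 3 * \<epsilon> / 4) \<le> \<Delta> / (1 + \<epsilon> / 2)"
        using assms by (auto intro!: divide_left_mono)
      then show ?thesis by (auto simp: wrong_def p1)
    qed
    then have "measure_pmf.prob (binomial_pmf d p) {k. wrong k} = 0"
      by (simp add: p1 measure_pmf_zero_iff set_pmf_binomial_eq)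
    then show ?thesis by (simp add: p1)
  next
    case True
    then have "p = 3 * (1 + \<epsilon>) / (\<epsilon>'\<^sup>2 * \<Delta>) * L" by (auto simp: p_def)
    then have mean: "p * \<Delta> / (1 + \<epsilon>) = 3 * L / \<epsilon>'\<^sup>2"
      using assms \<epsilon>' by (simp add: field_simps)
    have up: "(1 + \<epsilon>') / (1 + \<epsilon>) = 1 / (1 + 3 * \<epsilon> / 4)" and down: "(1 - \<epsilon>') / (1 + \<epsilon> / 2) = 1 / (1 + 3 * \<epsilon> / 4)"
      using \<open>0 < \<epsilon>\<close> by (simp_all add: \<epsilon>'_def divide_simps)
    have up': "(1 + \<epsilon>') * (p * \<Delta> / (1 + \<epsilon>)) = p * \<Delta> / (1 + 3 * \<epsilon> / 4)"
      using arg_cong[OF up, of "\<lambda>x. p * \<Delta> * x"] by (simp add: mult_ac)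
    have down': "(1 - \<epsilon>') * (p * \<Delta> / (1 + \<epsilon> / 2)) = p * \<Delta> / (1 + 3 * \<epsilon> / 4)"
      using arg_cong[OF down, of "\<lambda>x. p * \<Delta> * x"] by (simp add: mult_ac)
    consider "real d < \<Delta> / (1 + \<epsilon>)" | "\<Delta> / (1 + \<epsilon>) \<le> real d" "real d \<le> \<Delta> / (1 + \<epsilon> / 2)"
      | "\<Delta> / (1 + \<epsilon> / 2) < real d" by linarith
    then have "measure_pmf.prob (binomial_pmf d p) {k. wrong k} \<le> exp (- L)"
    proof cases
      case 1
      have "\<Delta> / (1 + \<epsilon>) \<le> \<Delta> / (1 + \<epsilon> / 2)" using assms by (auto intro!: divide_left_mono)
      with 1 have "wrong k \<Longrightarrow> (1 + \<epsilon>') * (p * \<Delta> / (1 + \<epsilon>)) \<le> real k" for k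
        unfolding up' by (auto simp: wrong_def split: if_splits)
      then have "measure_pmf.prob (binomial_pmf d p) {k. wrong k}
          \<le> measure_pmf.prob (binomial_pmf d p) {k. (1 + \<epsilon>') * (p * \<Delta> / (1 + \<epsilon>)) \<le> real k}"
        by (intro measure_pmf.finite_measure_mono) auto
      also have "\<dots> \<le> exp (- \<epsilon>'\<^sup>2 * (p * \<Delta> / (1 + \<epsilon>)) / 3)"
        using p \<epsilon>' mult_left_mono[OF less_imp_le[OF 1], of p]
        by (intro chernoff_upper) (auto simp: mult.commute)
      finally show ?thesis using \<epsilon>' unfolding mean by simp
    next
      case 2
      then have "\<not> wrong k" for k by (auto simp: wrong_def)
      then show ?thesis by simp
    next
      case 3
      have le: "\<Delta> / (1 + \<epsilon>) \<le> \<Delta> / (1 + \<epsilon> / 2)" using assms by (auto intro!: divide_left_mono)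
      with 3 have "wrong k \<Longrightarrow> real k \<le> (1 - \<epsilon>') * (p * \<Delta> / (1 + \<epsilon> / 2))" for k
        unfolding down' by (auto simp: wrong_def split: if_splits)
      then have "measure_pmf.prob (binomial_pmf d p) {k. wrong k}
          \<le> measure_pmf.prob (binomial_pmf d p) {k. real k \<le> (1 - \<epsilon>') * (p * \<Delta> / (1 + \<epsilon> / 2))}"
        by (intro measure_pmf.finite_measure_mono) auto
      also have "\<dots> \<le> exp (- \<epsilon>'\<^sup>2 * (p * \<Delta> / (1 + \<epsilon> / 2)) / 2)"
        using p \<epsilon>' assms(3-5) mult_left_mono[OF less_imp_le[OF 3], of p]
        by (intro chernoff_lower) (auto simp: mult.commute)
      also have "\<dots> \<le> exp (- L)"
      proof -
        \<comment> \<open>The larger critical degree raises the mean to at least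
          \<open>3 * L / \<epsilon>'\<^sup>2\<close>, so the exponent here is even at least
          \<open>3 * L / 2\<close>.\<close>
        define Y where "Y = \<epsilon>'\<^sup>2 * (p * \<Delta> / (1 + \<epsilon> / 2))"
        have "\<epsilon>'\<^sup>2 * (3 * L / \<epsilon>'\<^sup>2) \<le> Y"
          using mult_left_mono[OF le, of p] p unfolding mean[symmetric] Y_def by (intro mult_left_mono) auto
        then have "L \<le> Y / 2" using \<epsilon>' \<open>0 < L\<close> by simp
        then show ?thesis by (simp add: Y_def)
      qed
      finally show ?thesis .
    qed
    with True show ?thesis by simp
  qed
  finally show ?thesis .
qed

text \<open>The out-arcs of the current vertex are independent of those that were inspected before,
  which determine \<open>H\<close>; hence a union bound over the vertices applies.\<close>

lemma unsound_prob:
  fixes r :: real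
  assumes "finite U" "0 \<le> r"
    and "\<And>H v D. H \<subseteq> U \<Longrightarrow> v \<in> U \<Longrightarrow> finite D \<Longrightarrow> Pair v ` nbrs E H v \<subseteq> D \<Longrightarrow>
      measure_pmf.prob (Pi_pmf D False (\<lambda>_. bernoulli_pmf p)) {\<omega>. \<not> correct \<epsilon> p \<Delta> E H \<omega> v} \<le> r"
    and "H \<subseteq> U" "distinct vs" "set vs \<subseteq> U"
  shows "measure_pmf.prob (Pi_pmf (Sigma (set vs) (nbrs E U)) False (\<lambda>_. bernoulli_pmf p))
           {\<omega>. \<not> sound \<epsilon> p \<Delta> E vs H \<omega>} \<le> real (length vs) * r"
  using assms(4-6)
proof (induction vs arbitrary: H)
  case Nil
  then show ?case by simp
next
  case (Cons v vs)
  define A where "A = Pair v ` nbrs E U v"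
  define B where "B = Sigma (set vs) (nbrs E U)"
  define P where "P D = Pi_pmf D False (\<lambda>_::'a \<times> 'a. bernoulli_pmf p)" for D
  \<comment> \<open>\<open>mrg f g\<close> takes the out-arcs of \<open>v\<close> from
    \<open>f\<close> and all other coins from \<open>g\<close>; the product over
    \<open>A \<union> B\<close> is the law of \<open>mrg f g\<close> for independent
    \<open>f\<close> and \<open>g\<close>.\<close>
  define mrg where "mrg f g x = (if x \<in> A then f x else g x)" for f g :: "'a \<times> 'a \<Rightarrow> bool" and x
  define next_H where "next_H f = (if accepts \<epsilon> p \<Delta> E H f v then H - {v} else H)" for f
  have fin: "finite A" "finite B" using assms(1) by (auto simp: A_def B_def finite_nbrs)
  have disj: "A \<inter> B = {}" using Cons.prems by (auto simp: A_def B_def)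
  have nH: "nbrs E H v \<subseteq> nbrs E U v" using Cons.prems by (intro nbrs_mono)
  have AB: "Sigma (set (v # vs)) (nbrs E U) = A \<union> B" by (auto simp: A_def B_def)
  have union: "P (A \<union> B) = P A \<bind> (\<lambda>f. map_pmf (mrg f) (P B))"
    unfolding P_def Pi_pmf_union[OF fin disj] mrg_def
    by (simp add: pair_pmf_def map_bind_pmf map_pmf_def[of _ "Pi_pmf B False _"] bind_assoc_pmf bind_return_pmf)
  have "measure_pmf.prob (P (A \<union> B)) {\<omega>. \<not> sound \<epsilon> p \<Delta> E (v # vs) H \<omega>}
      \<le> measure_pmf.prob (P A) {f. \<not> correct \<epsilon> p \<Delta> E H f v} + real (length vs) * r"
    unfolding union
  proof (rule prob_bind_pmf_le)
    show "0 \<le> real (length vs) * r" using assms(2) by simp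
    fix f assume "f \<notin> {f. \<not> correct \<epsilon> p \<Delta> E H f v}"
    then have f: "correct \<epsilon> p \<Delta> E H f v" by simp
    \<comment> \<open>The visit of \<open>v\<close> reads only \<open>f\<close>, and the later
      visits read only \<open>g\<close> because \<open>v\<close> is not in \<open>vs\<close>. So
      \<open>next_H f\<close> is a fixed set from the viewpoint of \<open>g\<close>, and the
      induction hypothesis applies to it.\<close>
    have *: "mrg f g (v, w) = f (v, w)" if "w \<in> nbrs E H v" for g w
      using that nH by (auto simp: mrg_def A_def)
    have "sound \<epsilon> p \<Delta> E (v # vs) H (mrg f g) = sound \<epsilon> p \<Delta> E vs (next_H f) g" for g
    proof -
      have "sound \<epsilon> p \<Delta> E vs H' (mrg f g) = sound \<epsilon> p \<Delta> E vs H' g" for H'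
        using Cons.prems by (intro sound_cong) (auto simp: mrg_def A_def)
      moreover have "accepts \<epsilon> p \<Delta> E H (mrg f g) v = accepts \<epsilon> p \<Delta> E H f v"
        using * by (rule accepts_cong)
      moreover have "correct \<epsilon> p \<Delta> E H (mrg f g) v = correct \<epsilon> p \<Delta> E H f v"
        using * by (rule correct_cong)
      ultimately show ?thesis using f by (simp add: next_H_def)
    qed
    then have "measure_pmf.prob (map_pmf (mrg f) (P B)) {\<omega>. \<not> sound \<epsilon> p \<Delta> E (v # vs) H \<omega>}
      = measure_pmf.prob (P B) {\<omega>. \<not> sound \<epsilon> p \<Delta> E vs (next_H f) \<omega>}"
      by (simp add: vimage_def del: sound.simps)
    also have "\<dots> \<le> real (length vs) * r"
      unfolding P_def B_def using Cons.prems by (intro Cons.IH) (auto simp: next_H_def)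
    finally show "measure_pmf.prob (map_pmf (mrg f) (P B)) {\<omega>. \<not> sound \<epsilon> p \<Delta> E (v # vs) H \<omega>}
      \<le> real (length vs) * r" .
  qed
  also have "measure_pmf.prob (P A) {f. \<not> correct \<epsilon> p \<Delta> E H f v} \<le> r"
    unfolding P_def using Cons.prems fin nH by (intro assms(3)) (auto simp: A_def)
  finally show ?case unfolding AB P_def by (simp add: algebra_simps del: sound.simps)
qed

section \<open>The sweep as carried out on program states\<close>

lemma visit_out_pool:
  assumes "arcs s \<subseteq> arcs_in E U"
  shows "visit \<epsilon> p v s =
    (if accepts \<epsilon> p (dmax s) E (pool s) (\<lambda>a. a \<in> arcs s) v
     then track_peak (s\<lparr>out := out s @ [v], pool := pool s - {v}\<rparr>) else s)"
proof -
  \<comment> \<open>Sampled arcs are edges, so counting out-arcs into the pool is counting coins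
    over \<open>nbrs\<close>.\<close>
  have "{w \<in> pool s. (v, w) \<in> arcs s} = {w \<in> nbrs E (pool s) v. (v, w) \<in> arcs s}"
    using assms by (auto simp: nbrs_def arcs_in_def)
  then show ?thesis by (simp add: visit_def accepts_def estimate_def Let_def)
qed

text \<open>Nothing is assumed about the coins. The three copies of \<open>card V\<close> pay for
  \<open>out\<close>, \<open>alive\<close> and \<open>pool\<close>; the clause for
  \<open>dmax s < 1\<close> is what forces the loop to end.\<close>

lemma fold_visit_invariant:
  assumes "finite V" "distinct vs" "set vs \<subseteq> pool s" "alive s \<subseteq> V"
    "pool s = V - set (out s)" "distinct (out s)" "set (out s) \<subseteq> V"
  shows "\<exists>xs P R. fold (visit \<epsilon> p) vs s = s\<lparr>out := xs, pool := P, peak := R\<rparr> \<and>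
    P = V - set xs \<and> distinct xs \<and> set xs \<subseteq> V \<and> P \<subseteq> pool s \<and> (dmax s < 1 \<longrightarrow> P \<inter> set vs = {}) \<and>
    R \<le> max (peak s) (3 * card V + 2 * card (arcs s) + 13)"
  using assms(2-)
proof (induction vs arbitrary: s)
  case Nil
  then show ?case by (auto intro!: exI[of _ "out s"] exI[of _ "pool s"] exI[of _ "peak s"])
next
  case (Cons v vs)
  define t where "t = visit \<epsilon> p v s"
  have v: "v \<in> V" "v \<notin> set (out s)" "v \<notin> set vs" using Cons.prems by auto
  show ?case
  proof (cases "estimate p s v \<ge> dmax s / (1 + 3 * \<epsilon> / 4) \<or> dmax s < 1")
    case True
    then have t: "t = track_peak (s\<lparr>out := out s @ [v], pool := pool s - {v}\<rparr>)"
      by (simp add: t_def visit_def Let_def)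
    have "length (out s @ [v]) = card (set (out s @ [v]))"
      using Cons.prems v by (intro distinct_card[symmetric]) auto
    moreover have "set (out s @ [v]) \<subseteq> V" "pool s - {v} \<subseteq> V" using Cons.prems v by auto
    then have "card (set (out s @ [v])) \<le> card V" "card (alive s) \<le> card V" "card (pool s - {v}) \<le> card V"
      using Cons.prems(3) assms(1) by (blast intro: card_mono)+
    ultimately have peak: "peak t \<le> max (peak s) (3 * card V + 2 * card (arcs s) + 13)"
      by (simp add: t track_peak_def words_def)
    have "\<exists>xs P R. fold (visit \<epsilon> p) vs t = t\<lparr>out := xs, pool := P, peak := R\<rparr> \<and>
      P = V - set xs \<and> distinct xs \<and> set xs \<subseteq> V \<and> P \<subseteq> pool t \<and> (dmax t < 1 \<longrightarrow> P \<inter> set vs = {}) \<and>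
      R \<le> max (peak t) (3 * card V + 2 * card (arcs t) + 13)"
      using Cons.prems v by (intro Cons.IH) (auto simp: t track_peak_def)
    then obtain xs P R where "fold (visit \<epsilon> p) vs t = t\<lparr>out := xs, pool := P, peak := R\<rparr>"
      "P = V - set xs" "distinct xs" "set xs \<subseteq> V" "P \<subseteq> pool t" "dmax t < 1 \<longrightarrow> P \<inter> set vs = {}"
      "R \<le> max (peak t) (3 * card V + 2 * card (arcs t) + 13)" by blast
    then show ?thesis using peak
      by (intro exI[of _ xs] exI[of _ P] exI[of _ R]) (auto simp: t track_peak_def simp flip: t_def)
  next
    case False
    then have "t = s" by (simp add: t_def visit_def Let_def)
    with Cons.IH[of s] Cons.prems False show ?thesis by (simp flip: t_def)
  qed
qed

section \<open>DD prefixes\<close>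

definition dd_at :: "real \<Rightarrow> 'a set set \<Rightarrow> 'a set \<Rightarrow> 'a \<Rightarrow> bool" where
  "dd_at \<theta> E H v \<longleftrightarrow> nbrs E H v \<noteq> {} \<longrightarrow>
     (\<forall>u\<in>H. \<theta> * real (card (nbrs E H u)) \<le> real (card (nbrs E H v)))"

text \<open>\<open>G(v)\<close> depends only on the vertices placed before \<open>v\<close>. The DD
  condition at \<open>v\<close> is therefore settled when \<open>v\<close> is appended, and can be
  carried along as a property of prefixes.\<close>

definition dd_prefix :: "real \<Rightarrow> 'a set \<Rightarrow> 'a set set \<Rightarrow> 'a list \<Rightarrow> bool" where
  "dd_prefix \<theta> V E xs \<longleftrightarrow> (\<forall>i<length xs. dd_at \<theta> E (V - set (take i xs)) (xs ! i))"

lemma dd_prefix_Nil [simp]: "dd_prefix \<theta> V E []"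
  by (simp add: dd_prefix_def)

lemma dd_prefix_snoc:
  "dd_prefix \<theta> V E (xs @ [v]) \<longleftrightarrow> dd_prefix \<theta> V E xs \<and> dd_at \<theta> E (V - set xs) v"
  by (auto simp: dd_prefix_def less_Suc_eq nth_append)

lemma list_order_Image:
  assumes "distinct xs" "i < length xs"
  shows "list_order xs `` {xs ! i} = set xs - set (take i xs)"
proof -
  have "list_order xs `` {xs ! i} = (!) xs ` {i..<length xs}"
    using assms by (force simp: list_order_def nth_eq_iff_index_eq)
  also have "\<dots> = (!) xs ` {..<length xs} - (!) xs ` {..<i}"
  proof -
    have "{i..<length xs} = {..<length xs} - {..<i}" by auto
    also have "(!) xs ` \<dots> = (!) xs ` {..<length xs} - (!) xs ` {..<i}"
      by (rule inj_on_image_set_diff[where C = "{..<length xs}"]) (use assms in \<open>auto intro: inj_on_nth\<close>)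
    finally show ?thesis .
  qed
  also have "(!) xs ` {..<i} = set (take i xs)"
    using assms nth_image[of i xs] by (simp add: lessThan_atLeast0)
  finally show ?thesis
    using nth_image[of "length xs" xs] by (simp add: lessThan_atLeast0)
qed

lemma linear_order_list_order:
  assumes "distinct xs"
  shows "linear_order_on (set xs) (list_order xs)"
  unfolding linear_order_on_def partial_order_on_def preorder_on_def
proof (intro conjI)
  show "list_order xs \<subseteq> set xs \<times> set xs" by (auto simp: list_order_def)
  show "refl_on (set xs) (list_order xs)"
    by (fastforce simp: refl_on_def list_order_def in_set_conv_nth)
  show "trans (list_order xs)"
    using assms by (fastforce simp: trans_def list_order_def nth_eq_iff_index_eq)
  show "antisym (list_order xs)"
    using assms by (auto simp: antisym_def list_order_def nth_eq_iff_index_eq)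
  show "total_on (set xs) (list_order xs)"
    by (auto simp: total_on_def list_order_def in_set_conv_nth) (metis nle_le)
qed

lemma dd_order_of_prefix:
  assumes "simple_graph V E" "distinct xs" "set xs = V" "dd_prefix \<theta> V E xs"
  shows "dd_order \<theta> V E (list_order xs)"
  unfolding dd_order_def
proof (intro conjI ballI impI)
  show "linear_order_on V (list_order xs)" using linear_order_list_order assms by blast
  fix v u assume "v \<in> V" "1 \<le> degree_in (upper_edges E (list_order xs) v) v" "u \<in> V" "(v, u) \<in> list_order xs"
  moreover obtain i where i: "i < length xs" "v = xs ! i"
    using \<open>v \<in> V\<close> assms(3) by (auto simp: in_set_conv_nth)
  define H where "H = V - set (take i xs)"
  have H: "list_order xs `` {v} = H"
    using list_order_Image[OF assms(2) i(1)] by (simp add: i H_def assms(3))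
  have "v \<in> H" unfolding H[symmetric] using i by (auto simp: list_order_def)
  moreover have "u \<in> H" using calculation H by auto
  ultimately have "nbrs E H v \<noteq> {}" "u \<in> H"
    by (auto simp: upper_edges_def H degree_in_induced_edges[OF assms(1)])
  moreover have "dd_at \<theta> E H v" using assms(4) i by (simp add: dd_prefix_def H_def)
  ultimately have "\<theta> * real (card (nbrs E H u)) \<le> real (card (nbrs E H v))"
    by (auto simp: dd_at_def)
  then show "real (degree_in (upper_edges E (list_order xs) v) v)
      \<ge> \<theta> * real (degree_in (upper_edges E (list_order xs) v) u)"
    using \<open>v \<in> H\<close> \<open>u \<in> H\<close> by (simp add: upper_edges_def H degree_in_induced_edges[OF assms(1)])
qed

text \<open>The pool only shrinks during a sweep, so degrees only fall: the bound
  \<open>dmax s\<close> is still valid when a vertex is appended, and a bound obtained at a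
  rejection is still valid in the final pool.\<close>

lemma fold_visit_sound:
  assumes "simple_graph V E" "0 < \<epsilon>" "0 < dmax s" "distinct vs" "set vs \<subseteq> pool s" "pool s = V - set (out s)"
    "arcs s \<subseteq> arcs_in E U"
    "sound \<epsilon> p (dmax s) E vs (pool s) (\<lambda>a. a \<in> arcs s)"
    "dd_prefix (1 / (1 + \<epsilon>)) V E (out s)"
    "\<And>u. u \<in> pool s \<Longrightarrow> real (card (nbrs E (pool s) u)) \<le> dmax s"
  defines "s' \<equiv> fold (visit \<epsilon> p) vs s"
  shows "dd_prefix (1 / (1 + \<epsilon>)) V E (out s') \<and> pool s' \<subseteq> pool s \<and>
    (\<forall>v\<in>set vs \<inter> pool s'. real (card (nbrs E (pool s') v)) \<le> dmax s / (1 + \<epsilon> / 2))"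
  unfolding s'_def using assms(3-10)
proof (induction vs arbitrary: s)
  case Nil
  then show ?case by simp
next
  case (Cons v vs)
  have fin: "finite (pool s)" using assms(1) Cons.prems by (simp add: simple_graph_def)
  have mono: "card (nbrs E H' u) \<le> card (nbrs E H u)" if "H' \<subseteq> H" "H \<subseteq> pool s" for H H' u
    using that fin by (intro card_mono finite_nbrs nbrs_mono) (auto intro: finite_subset)
  show ?case
  proof (cases "accepts \<epsilon> p (dmax s) E (pool s) (\<lambda>a. a \<in> arcs s) v")
    case True
    define t where "t = track_peak (s\<lparr>out := out s @ [v], pool := pool s - {v}\<rparr>)"
    have visit: "visit \<epsilon> p v s = t" using True visit_out_pool[OF Cons.prems(5)] by (simp add: t_def)
    have ok: "nbrs E (pool s) v = {} \<or> dmax s / (1 + \<epsilon>) \<le> real (card (nbrs E (pool s) v))"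
      using Cons.prems(6) True by (simp add: correct_def)
    have "dd_at (1 / (1 + \<epsilon>)) E (pool s) v"
      unfolding dd_at_def
    proof (intro impI ballI)
      fix u assume "nbrs E (pool s) v \<noteq> {}" "u \<in> pool s"
      then have "dmax s / (1 + \<epsilon>) \<le> real (card (nbrs E (pool s) v))" "real (card (nbrs E (pool s) u)) \<le> dmax s"
        using ok Cons.prems(8) by auto
      then show "1 / (1 + \<epsilon>) * real (card (nbrs E (pool s) u)) \<le> real (card (nbrs E (pool s) v))"
        using \<open>0 < \<epsilon>\<close> by (simp add: field_simps)
    qed
    then have "dd_prefix (1 / (1 + \<epsilon>)) V E (out t)"
      using Cons.prems by (simp add: t_def track_peak_def dd_prefix_snoc)
    moreover have "real (card (nbrs E (pool t) u)) \<le> dmax t" if "u \<in> pool t" for u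
      using Cons.prems(8)[of u] mono[of "pool t" "pool s" u] that by (auto simp: t_def track_peak_def)
    ultimately have "dd_prefix (1 / (1 + \<epsilon>)) V E (out (fold (visit \<epsilon> p) vs t)) \<and> pool (fold (visit \<epsilon> p) vs t) \<subseteq> pool t \<and>
      (\<forall>v\<in>set vs \<inter> pool (fold (visit \<epsilon> p) vs t).
        real (card (nbrs E (pool (fold (visit \<epsilon> p) vs t)) v)) \<le> dmax t / (1 + \<epsilon> / 2))"
      using Cons.prems True by (intro Cons.IH) (auto simp: t_def track_peak_def)
    then show ?thesis by (auto simp: visit) (auto simp: t_def track_peak_def)
  next
    case False
    have visit: "visit \<epsilon> p v s = s" using False visit_out_pool[OF Cons.prems(5)] by simp
    let ?t = "fold (visit \<epsilon> p) vs s"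
    have IH: "dd_prefix (1 / (1 + \<epsilon>)) V E (out ?t) \<and> pool ?t \<subseteq> pool s \<and>
      (\<forall>v\<in>set vs \<inter> pool ?t. real (card (nbrs E (pool ?t) v)) \<le> dmax s / (1 + \<epsilon> / 2))"
      using Cons.prems False by (intro Cons.IH) auto
    have "real (card (nbrs E (pool ?t) v)) \<le> real (card (nbrs E (pool s) v))"
      using mono[of "pool ?t" "pool s"] IH by simp
    also have "\<dots> \<le> dmax s / (1 + \<epsilon> / 2)"
      using Cons.prems(6) False by (simp add: correct_def)
    finally show ?thesis using IH by (auto simp: visit)
  qed
qed

section \<open>The loop\<close>

text \<open>Downward induction on the round index. Termination comes from \<open>final\<close>:
  under the invariant no vertex is alive after \<open>M\<close> rounds. Runs that stop earlier are
  covered by \<open>good\<close>, as the remaining \<open>q\<close> are nonnegative.\<close>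

lemma while_loop_prob:
  fixes q :: "nat \<Rightarrow> real"
  assumes step: "\<And>k s. k < M \<Longrightarrow> I k s \<Longrightarrow> alive s \<noteq> {} \<Longrightarrow>
      1 - q k \<le> measure_pmf.prob (iteration \<epsilon> \<delta> n es enum s) {s'. I (Suc k) s'}"
    and final: "\<And>s. I M s \<Longrightarrow> alive s = {}"
    and good: "\<And>k s. k \<le> M \<Longrightarrow> I k s \<Longrightarrow> alive s = {} \<Longrightarrow> s \<in> G"
    and q: "\<And>k. 0 \<le> q k" "sum q {..<M} \<le> 1"
    and "k \<le> M" "I k s"
  shows "1 - sum q {k..<M} \<le> measure (measure_spmf (while_loop \<epsilon> \<delta> n es enum s)) G"
  using assms(6,7)
proof (induction k arbitrary: s rule: inc_induct)
  case base
  then have "alive s = {}" "s \<in> G" using final good by blast+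
  then show ?case by (simp add: while_loop.simps measure_return_pmf measure_measure_spmf_conv_measure_pmf)
next
  case (step k)
  show ?case
  proof (cases "alive s = {}")
    case True
    then have "s \<in> G" using good[of k s] step by simp
    then show ?thesis using True q(1)
      by (simp add: while_loop.simps measure_measure_spmf_conv_measure_pmf sum_nonneg)
  next
    case False
    define W where "W = while_loop \<epsilon> \<delta> n es enum"
    define N where "N = iteration \<epsilon> \<delta> n es enum s"
    define r where "r = 1 - sum q {Suc k..<M}"
    have "sum q {Suc k..<M} \<le> sum q {..<M}" using q(1) by (intro sum_mono2) auto
    then have r: "0 \<le> r" "r \<le> 1" using q by (auto simp: r_def sum_nonneg)
    have int: "integrable N f" if "\<And>x. \<bar>f x\<bar> \<le> 1" for f :: "'a state \<Rightarrow> real"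
      using that by (intro measure_pmf.integrable_const_bound[where B = 1]) auto
    have "1 - sum q {k..<M} = r - q k"
      using step.hyps by (simp add: r_def sum.atLeast_Suc_lessThan)
    \<comment> \<open>Failure probabilities may simply be added because
      \<open>(1 - q k) * r \<ge> r - q k\<close> for \<open>r \<le> 1\<close>;
      \<open>sum q {..<M} \<le> 1\<close> ensures that \<open>r\<close> is nonnegative.\<close>
    also have "\<dots> \<le> r - q k * r" using r q(1)[of k] by (simp add: mult_left_le)
    also have "\<dots> = (1 - q k) * r" by (simp add: algebra_simps)
    also have "\<dots> \<le> measure_pmf.prob N {s'. I (Suc k) s'} * r"
      using assms(1)[of k s] step False r by (intro mult_right_mono) (auto simp: N_def)
    also have "\<dots> = measure_pmf.expectation N (\<lambda>s'. indicator {s'. I (Suc k) s'} s' * r)"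
      by simp
    also have "\<dots> \<le> measure_pmf.expectation N (\<lambda>s'. measure (measure_spmf (W s')) G)"
    proof (rule integral_mono)
      show "integrable N (\<lambda>s'. indicator {s'. I (Suc k) s'} s' * r)"
        using r by (intro int) (auto simp: indicator_def)
      show "integrable N (\<lambda>s'. measure (measure_spmf (W s')) G)"
        by (intro int) (simp add: measure_measure_spmf_conv_measure_pmf)
      show "indicator {s'. I (Suc k) s'} s' * r \<le> measure (measure_spmf (W s')) G" for s'
        using step.IH[of s'] by (auto simp: indicator_def W_def r_def)
    qed
    also have "\<dots> = measure (measure_spmf (W s)) G"
      using False unfolding W_def
      by (subst (2) while_loop.simps)
         (simp add: measure_measure_spmf_conv_measure_pmf prob_bind_pmf N_def)
    finally show ?thesis by (simp add: W_def)
  qed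
qed

text \<open>Everything after the scan is deterministic, so an iteration is the image of the scan
  under \<open>post\<close>, and events about the new state become events about the sampled
  arcs.\<close>

definition post :: "real \<Rightarrow> real \<Rightarrow> 'a list \<Rightarrow> 'a state \<Rightarrow> 'a state" where
  "post \<epsilon> p vs s =
     (let s' = fold (visit \<epsilon> p) vs (track_peak (s\<lparr>pool := alive s\<rparr>))
      in s'\<lparr>alive := pool s', dmax := dmax s' / (1 + \<epsilon> / 2)\<rparr>)"

lemma iteration_post:
  "iteration \<epsilon> \<delta> n es enum s = map_pmf (post \<epsilon> (sample_prob \<epsilon> \<delta> n (dmax s)) (enum s))
     (scan (sample_prob \<epsilon> \<delta> n (dmax s)) (es (passes s)) (track_peak (s\<lparr>arcs := {}, passes := passes s + 1\<rparr>)))"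
  by (simp add: iteration_def post_def Let_def map_pmf_def)

section \<open>Invariants of the loop for a fixed input\<close>

locale dd_run =
  fixes V :: "'a set" and E :: "'a set set" and es :: "nat \<Rightarrow> ('a \<times> 'a) list"
    and enum :: "'a state \<Rightarrow> 'a list" and \<epsilon> :: real and \<delta> :: real
  assumes graph: "simple_graph V E" and stream: "\<And>k. edge_stream E (es k)"
    and enum: "valid_enum enum" and eps: "0 < \<epsilon>" and delta: "0 < \<delta>" "\<delta> < 1"
begin

abbreviation n :: nat where "n \<equiv> card V"

abbreviation b :: real where "b \<equiv> 1 + \<epsilon> / 2"

definition T :: real where "T = log b (real n)"

definition L :: real where "L = ln (2 * real n * T / \<delta>)"

text \<open>This is \<open>n * \<Delta>\<close> times the unclipped value of \<open>p\<close>, where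
  \<open>n * \<Delta>\<close> bounds the number of arcs offered. \<Delta> cancels, so one memory
  bound serves all rounds.\<close>

definition arc_mean :: real where
  "arc_mean = 3 * real n * (1 + \<epsilon>) / (\<epsilon> / (4 + 3 * \<epsilon>))\<^sup>2 * L"

text \<open>\<open>3 * n\<close> is for the three vertex collections; each of at most
  \<open>3 * arc_mean\<close> arcs takes two words.\<close>

definition peak_bound :: real where "peak_bound = 3 * real n + 6 * arc_mean + 13"

text \<open>After \<open>\<lceil>T\<rceil>\<close> divisions \<Delta> is below 1; the additional
  round accepts everything left.\<close>

definition rounds :: nat where "rounds = nat \<lceil>T\<rceil> + 1"

text \<open>Holds along every run, whatever the coins. The last clause records that a round entered
  with \<open>\<Delta> < 1\<close> leaves no vertex; it refers to \<open>j\<close> because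
  \<open>dmax s\<close> has already been divided.\<close>

definition base_inv :: "nat \<Rightarrow> 'a state \<Rightarrow> bool" where
  "base_inv k s \<longleftrightarrow> dmax s = (real n - 1) / b ^ k \<and> passes s = k \<and> distinct (out s) \<and>
     set (out s) \<subseteq> V \<and> alive s = V - set (out s) \<and> pool s \<subseteq> V \<and>
     (\<forall>j. k = Suc j \<longrightarrow> (real n - 1) / b ^ j < 1 \<longrightarrow> alive s = {})"

definition good_inv :: "nat \<Rightarrow> 'a state \<Rightarrow> bool" where
  "good_inv k s \<longleftrightarrow> base_inv k s \<and> dd_prefix (1 / (1 + \<epsilon>)) V E (out s) \<and>
     (\<forall>v\<in>alive s. real (card (nbrs E (alive s) v)) \<le> dmax s) \<and> real (peak s) \<le> peak_bound"

lemma finite_V: "finite V"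
  using graph by (simp add: simple_graph_def)

lemma enum_alive: "base_inv k s \<Longrightarrow> distinct (enum s) \<and> set (enum s) = alive s"
  using enum finite_V by (simp add: valid_enum_def base_inv_def)

abbreviation scan_start :: "'a state \<Rightarrow> 'a state" where
  "scan_start s \<equiv> track_peak (s\<lparr>arcs := {}, passes := passes s + 1\<rparr>)"

lemma scan_result:
  assumes "base_inv k s" "t \<in> set_pmf (scan p (es k) (scan_start s))"
  shows "\<exists>A P. t = s\<lparr>passes := Suc k, arcs := A, peak := P\<rparr> \<and> A \<subseteq> arcs_in E (alive s) \<and> finite A \<and>
    P \<le> max (peak s) (3 * n + 2 * card A + 13)"
proof -
  from scan_support[OF assms(2)] obtain A P where A: "t = (scan_start s)\<lparr>arcs := A, peak := P\<rparr>"
    "A \<subseteq> {(u, v). u \<in> alive s \<and> v \<in> alive s \<and> ((u, v) \<in> set (es k) \<or> (v, u) \<in> set (es k))}" "finite A"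
    "P \<le> max (peak (scan_start s)) (words t)"
    by (auto simp: track_peak_def)
  have "card (set (out s)) \<le> n" "card (alive s) \<le> n" "card (pool s) \<le> n"
    using assms(1) finite_V by (auto simp: base_inv_def intro!: card_mono)
  moreover have "length (out s) = card (set (out s))"
    using assms(1) by (simp add: base_inv_def distinct_card)
  ultimately have "P \<le> max (peak s) (3 * n + 2 * card A + 13)"
    using A by (auto simp: track_peak_def words_def)
  then show ?thesis
    using A edge_stream_arcs[OF stream, of "alive s" k] assms(1)
    by (intro exI[of _ A] exI[of _ P]) (auto simp: track_peak_def base_inv_def)
qed

lemma post_base_inv:
  assumes "base_inv k s" "t \<in> set_pmf (scan p (es k) (scan_start s))"
  shows "base_inv (Suc k) (post \<epsilon> p (enum s) t) \<and>
    peak (post \<epsilon> p (enum s) t) \<le> max (peak s) (3 * n + 2 * card (arcs t) + 13)"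
proof -
  obtain A P where t: "t = s\<lparr>passes := Suc k, arcs := A, peak := P\<rparr>"
    and P: "P \<le> max (peak s) (3 * n + 2 * card A + 13)"
    using scan_result[OF assms] by blast
  define s2 where "s2 = track_peak (t\<lparr>pool := alive t\<rparr>)"
  note inv = assms(1)[unfolded base_inv_def]
  have "\<exists>xs Q R. fold (visit \<epsilon> p) (enum s) s2 = s2\<lparr>out := xs, pool := Q, peak := R\<rparr> \<and>
    Q = V - set xs \<and> distinct xs \<and> set xs \<subseteq> V \<and> Q \<subseteq> pool s2 \<and> (dmax s2 < 1 \<longrightarrow> Q \<inter> set (enum s) = {}) \<and>
    R \<le> max (peak s2) (3 * card V + 2 * card (arcs s2) + 13)"
    using inv enum_alive[OF assms(1)] finite_V
    by (intro fold_visit_invariant) (auto simp: s2_def t track_peak_def)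
  then obtain xs Q R where f: "fold (visit \<epsilon> p) (enum s) s2 = s2\<lparr>out := xs, pool := Q, peak := R\<rparr>"
    "Q = V - set xs" "distinct xs" "set xs \<subseteq> V" "Q \<subseteq> pool s2" "dmax s2 < 1 \<longrightarrow> Q \<inter> set (enum s) = {}"
    "R \<le> max (peak s2) (3 * card V + 2 * card (arcs s2) + 13)" by blast
  have res: "post \<epsilon> p (enum s) t = s2\<lparr>out := xs, pool := Q, peak := R, alive := Q, dmax := dmax s2 / b\<rparr>"
    unfolding post_def s2_def[symmetric] f(1) by simp
  have "card (set (out s)) \<le> n" "card (alive s) \<le> n"
    using inv finite_V by (auto intro!: card_mono)
  moreover have "length (out s) = card (set (out s))"
    using inv by (simp add: distinct_card)
  ultimately have "peak s2 \<le> max (peak s) (3 * n + 2 * card A + 13)"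
    using P by (simp add: s2_def t track_peak_def words_def)
  moreover have "(real n - 1) / b ^ k < 1 \<longrightarrow> Q = {}"
    using f(5,6) enum_alive[OF assms(1)] inv by (auto simp: s2_def t track_peak_def)
  ultimately show ?thesis
    using f inv unfolding res base_inv_def
    by (auto simp: s2_def t track_peak_def field_simps)
qed

lemma post_good_inv:
  assumes "good_inv k s" "t \<in> set_pmf (scan p (es k) (scan_start s))" "0 < dmax s"
    and "sound \<epsilon> p (dmax s) E (enum s) (alive s) (\<lambda>a. a \<in> arcs t)"
    and "real (card (arcs t)) \<le> 3 * arc_mean"
  shows "good_inv (Suc k) (post \<epsilon> p (enum s) t)"
proof -
  have base: "base_inv k s" using assms(1) by (simp add: good_inv_def)
  obtain A P where t: "t = s\<lparr>passes := Suc k, arcs := A, peak := P\<rparr>" and A: "A \<subseteq> arcs_in E (alive s)"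
    using scan_result[OF base assms(2)] by blast
  define s2 where "s2 = track_peak (t\<lparr>pool := alive t\<rparr>)"
  define s3 where "s3 = fold (visit \<epsilon> p) (enum s) s2"
  have post: "post \<epsilon> p (enum s) t = s3\<lparr>alive := pool s3, dmax := dmax s3 / b\<rparr>"
    by (simp add: post_def s3_def s2_def Let_def)
  have "dd_prefix (1 / (1 + \<epsilon>)) V E (out s3) \<and> pool s3 \<subseteq> pool s2 \<and>
    (\<forall>v\<in>set (enum s) \<inter> pool s3. real (card (nbrs E (pool s3) v)) \<le> dmax s2 / (1 + \<epsilon> / 2))"
    unfolding s3_def using assms base enum_alive[OF base] A
    by (intro fold_visit_sound[where U = "alive s"])
       (auto simp: s2_def t track_peak_def graph eps good_inv_def base_inv_def)
  then have *: "dd_prefix (1 / (1 + \<epsilon>)) V E (out s3)"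
    "\<And>v. v \<in> pool s3 \<Longrightarrow> real (card (nbrs E (pool s3) v)) \<le> dmax s / b"
    using enum_alive[OF base] by (auto simp: s2_def t track_peak_def)
  note post_inv = post_base_inv[OF base assms(2)]
  have "dmax (post \<epsilon> p (enum s) t) = dmax s / b"
    using post_inv base by (simp add: base_inv_def field_simps)
  moreover have "real (peak (post \<epsilon> p (enum s) t)) \<le> peak_bound"
    using post_inv assms(1,5) by (auto simp: good_inv_def peak_bound_def)
  moreover have "dmax s3 = dmax s" using calculation(1) eps by (simp add: post)
  ultimately show ?thesis using * post_inv by (simp add: good_inv_def post)
qed

text \<open>\<open>T \<ge> 1\<close> gives \<open>n \<ge> b > 1\<close>, and then the argument of
  the logarithm in \<open>L\<close> is at least 4, above \<open>exp 1\<close>. In particular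
  \<open>p\<close> is positive in this regime.\<close>

lemma one_le_T_bounds:
  assumes "1 \<le> T"
  shows "1 \<le> L" "b \<le> real n" "2 \<le> n"
proof -
  have "n \<noteq> 0"
  proof
    assume "n = 0"
    then have "T = 0" by (simp add: T_def log_def)
    with assms show False by simp
  qed
  then show *: "b \<le> real n"
    using assms eps by (simp add: T_def le_log_iff)
  then show n: "2 \<le> n" using eps by linarith
  have "exp 1 \<le> (3::real)" by (rule exp_le)
  also have "3 \<le> 2 * 2 * 1 / (1::real)" by simp
  also have "\<dots> \<le> 2 * real n * T / \<delta>"
    using n assms delta by (intro frac_le mult_mono) auto
  finally show "1 \<le> L"
    unfolding L_def by (subst ln_ge_iff) (use exp_gt_zero[of "1::real"] in linarith)+
qed

lemma sample_prob_eq: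
  "sample_prob \<epsilon> \<delta> n D = min (3 * (1 + \<epsilon>) / ((\<epsilon> / (4 + 3 * \<epsilon>))\<^sup>2 * D) * L) 1"
  by (simp add: sample_prob_def Let_def L_def T_def)

lemma sparse_constant:
  "9 \<le> 1 / (\<epsilon> / (4 + 3 * \<epsilon>))\<^sup>2"
proof -
  have "3 \<le> (4 + 3 * \<epsilon>) / \<epsilon>" using eps by (simp add: field_simps)
  then have "3\<^sup>2 \<le> ((4 + 3 * \<epsilon>) / \<epsilon>)\<^sup>2" by (intro power_mono) auto
  then show ?thesis by (simp add: power_divide)
qed

text \<open>If \<open>p < 1\<close> then \<open>\<Delta> > b\<close>, so at most \<open>T\<close> of the up to \<open>T + 1\<close> rounds with \<open>\<Delta> \<ge> 1\<close> are
  random.\<close>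

lemma sampling_round:
  assumes "1 \<le> T" "sample_prob \<epsilon> \<delta> n ((real n - 1) / b ^ k) < 1"
  shows "real (Suc k) \<le> T"
proof -
  note L = one_le_T_bounds[OF assms(1)]
  define \<Delta> where "\<Delta> = (real n - 1) / b ^ k"
  define c where "c = 1 / (\<epsilon> / (4 + 3 * \<epsilon>))\<^sup>2"
  have \<Delta>: "0 < \<Delta>" using L eps by (simp add: \<Delta>_def)
  have "3 * (1 + \<epsilon>) * c * L / \<Delta> < 1"
    using assms(2) by (simp add: sample_prob_eq \<Delta>_def c_def min_less_iff_disj mult_ac)
  then have "(1 + \<epsilon>) * (3 * (c * L)) < \<Delta>" using \<Delta> by (simp add: field_simps)
  moreover have "1 \<le> 3 * (c * L)"
  proof -
    have "9 * 1 \<le> c * L" using sparse_constant L unfolding c_def by (intro mult_mono) auto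
    then show ?thesis by simp
  qed
  then have "(1 + \<epsilon>) * 1 \<le> (1 + \<epsilon>) * (3 * (c * L))"
    using eps by (intro mult_left_mono) auto
  ultimately have "1 + \<epsilon> < \<Delta>" unfolding mult_1_right by (rule le_less_trans[rotated])
  then have "b \<le> \<Delta>" using eps by simp
  then have "b * b ^ k \<le> real n - 1" using eps unfolding \<Delta>_def by (subst (asm) pos_le_divide_eq) auto
  then have "b ^ Suc k \<le> real n" by (simp only: power_Suc)
  then have "b powr real (Suc k) \<le> real n" using eps by (subst powr_realpow) auto
  then show ?thesis unfolding T_def using eps L by (subst le_log_iff) auto
qed

text \<open>The charge depends on the index alone; all rounds with \<open>p < 1\<close> are among
  those charged. Half of \<open>\<delta> / T\<close> is for misjudged vertices, half for too many
  arcs.\<close>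

definition fail_prob :: "nat \<Rightarrow> real" where
  "fail_prob k = (if real (Suc k) \<le> T then \<delta> / T else 0)"

lemma sum_fail_prob: "1 \<le> T \<Longrightarrow> sum fail_prob {..<N} \<le> \<delta>"
proof -
  assume T: "1 \<le> T"
  have "sum fail_prob {..<N} = (\<Sum>k\<in>{k\<in>{..<N}. real (Suc k) \<le> T}. \<delta> / T)"
    unfolding fail_prob_def by (subst sum.inter_filter) auto
  also have "\<dots> = real (card {k\<in>{..<N}. real (Suc k) \<le> T}) * (\<delta> / T)"
    by simp
  also have "\<dots> \<le> T * (\<delta> / T)"
  proof (rule mult_right_mono)
    \<comment> \<open>Indices start at 0, so \<open>Suc k \<le> T\<close> leaves at most
      \<open>\<lfloor>T\<rfloor>\<close> of them.\<close>
    have "{k\<in>{..<N}. real (Suc k) \<le> T} \<subseteq> {..<nat \<lfloor>T\<rfloor>}" 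
      using le_nat_floor[of "Suc _" T] by (auto simp: Suc_le_eq)
    then have "card {k\<in>{..<N}. real (Suc k) \<le> T} \<le> nat \<lfloor>T\<rfloor>"
      using card_mono[of "{..<nat \<lfloor>T\<rfloor>}"] by simp
    then show "real (card {k\<in>{..<N}. real (Suc k) \<le> T}) \<le> T" using T by linarith
  qed (use T delta in simp)
  finally show ?thesis using T by simp
qed

lemma exp_minus_L:
  assumes "1 \<le> T"
  shows "real n * exp (- L) = \<delta> / (2 * T)"
proof -
  have "exp (- L) = \<delta> / (2 * real n * T)"
    using assms one_le_T_bounds[OF assms] delta by (simp add: exp_minus L_def)
  then show ?thesis using one_le_T_bounds[OF assms] by simp
qed

text \<open>Both bad events are estimated for the product of coins and then transported along the
  law of \<open>arcs\<close> after the scan; on the complement the deterministic rest of the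
  iteration preserves \<open>good_inv\<close>.\<close>

lemma round_prob:
  assumes T: "1 \<le> T" and inv: "good_inv k s"
  shows "1 - fail_prob k \<le> measure_pmf.prob (iteration \<epsilon> \<delta> n es enum s) {s'. good_inv (Suc k) s'}"
proof -
  note L = one_le_T_bounds[OF T]
  have base: "base_inv k s" and k: "passes s = k" and dmax: "dmax s = (real n - 1) / b ^ k"
    using inv by (auto simp: good_inv_def base_inv_def)
  define p where "p = sample_prob \<epsilon> \<delta> n (dmax s)"
  define U where "U = alive s"
  define D where "D = arcs_in E U"
  define N where "N = Pi_pmf D False (\<lambda>_. bernoulli_pmf p)"
  define S where "S = scan p (es k) (scan_start s)"
  have dpos: "0 < dmax s" using L eps by (simp add: dmax)
  have p_eq: "p = min (3 * (1 + \<epsilon>) / ((\<epsilon> / (4 + 3 * \<epsilon>))\<^sup>2 * dmax s) * L) 1"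
    by (simp add: p_def sample_prob_eq)
  have p: "0 < p" "p \<le> 1" using L eps dpos by (auto simp: p_eq)
  have U: "finite U" "card U \<le> n" using base finite_V by (auto simp: U_def base_inv_def card_mono)
  have degs: "real (card (nbrs E U v)) \<le> dmax s" if "v \<in> U" for v
    using inv that by (simp add: good_inv_def U_def)
  have finD: "finite D" using U by (simp add: D_def finite_arcs_in)
  have c1: "9 \<le> 1 / (\<epsilon> / (4 + 3 * \<epsilon>))\<^sup>2" by (rule sparse_constant)
  have mean: "arc_mean = real n * dmax s * (3 * (1 + \<epsilon>) / ((\<epsilon> / (4 + 3 * \<epsilon>))\<^sup>2 * dmax s) * L)"
    using dpos by (simp add: arc_mean_def)
  have L_le: "L \<le> arc_mean"
  proof -
    have "1 * 1 * 9 * L \<le> (3 * real n) * (1 + \<epsilon>) * (1 / (\<epsilon> / (4 + 3 * \<epsilon>))\<^sup>2) * L"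
      using c1 L eps by (intro mult_right_mono mult_mono) auto
    then show ?thesis using L by (simp add: arc_mean_def)
  qed
  have cardD: "real (card D) \<le> real n * dmax s"
  proof -
    have "real (card D) \<le> real (card U) * dmax s"
      unfolding D_def using U degs by (intro card_arcs_in_le) auto
    also have "\<dots> \<le> real n * dmax s" using U dpos by (intro mult_right_mono) auto
    finally show ?thesis .
  qed
  \<comment> \<open>One value serves both events:
    \<open>exp (- arc_mean) \<le> exp (- L) \<le> n * exp (- L)\<close>, so each costs at most
    \<open>\<delta> / (2 * T)\<close>.\<close>
  define r where "r = (if p < 1 then exp (- L) else 0)"
  have unsound: "measure_pmf.prob N {\<omega>. \<not> sound \<epsilon> p (dmax s) E (enum s) U \<omega>} \<le> real n * r"
  proof -
    have "measure_pmf.prob (Pi_pmf (Sigma (set (enum s)) (nbrs E U)) False (\<lambda>_. bernoulli_pmf p))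
           {\<omega>. \<not> sound \<epsilon> p (dmax s) E (enum s) U \<omega>} \<le> real (length (enum s)) * r"
    proof (rule unsound_prob)
      fix H v C assume C: "H \<subseteq> U" "v \<in> U" "finite C" "Pair v ` nbrs E H v \<subseteq> C"
      have "card (nbrs E H v) \<le> card (nbrs E U v)"
        using C U by (intro card_mono nbrs_mono finite_nbrs)
      then have "real (card (nbrs E H v)) \<le> dmax s" using degs[OF C(2)] by linarith
      moreover have "finite (nbrs E H v)"
        using finite_nbrs[OF finite_subset[OF C(1) U(1)]] .
      ultimately have "nbrs E H v = {}" if "dmax s < 1"
        using that by (simp add: card_gt_0_iff[symmetric] flip: card_0_eq)
      then show "measure_pmf.prob (Pi_pmf C False (\<lambda>_. bernoulli_pmf p)) {\<omega>. \<not> correct \<epsilon> p (dmax s) E H \<omega> v} \<le> r"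
        unfolding r_def p_eq using eps L dpos C by (intro incorrect_prob) auto
    qed (use enum_alive[OF base] U in \<open>auto simp: U_def r_def\<close>)
    moreover have "real (length (enum s)) * r \<le> real n * r"
      using enum_alive[OF base] U distinct_card[of "enum s"]
      by (intro mult_right_mono) (auto simp: U_def r_def)
    ultimately show ?thesis
      using enum_alive[OF base] by (simp add: N_def D_def arcs_in_Sigma U_def)
  qed
  have many: "measure_pmf.prob N {\<omega>. \<not> real (card {a. \<omega> a}) \<le> 3 * arc_mean} \<le> real n * r"
  proof -
    have "measure_pmf.prob N {\<omega>. \<not> real (card {a. \<omega> a}) \<le> 3 * arc_mean}
        \<le> measure_pmf.prob N {\<omega>. 3 * arc_mean < real (card {a\<in>D. \<omega> a})}"
    proof (rule measure_pmf.finite_measure_mono_AE)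
      have "{a. \<omega> a} = {a\<in>D. \<omega> a}" if "\<omega> \<in> set_pmf N" for \<omega>
        using that set_Pi_pmf_subset[OF finD, of False] by (auto simp: N_def)
      then show "AE \<omega> in N. \<omega> \<in> {\<omega>. \<not> real (card {a. \<omega> a}) \<le> 3 * arc_mean} \<longrightarrow>
          \<omega> \<in> {\<omega>. 3 * arc_mean < real (card {a\<in>D. \<omega> a})}"
        by (simp add: AE_measure_pmf_iff)
    qed simp
    also have "\<dots> \<le> real n * r"
    proof (cases "p < 1")
      case True
      then have "p = 3 * (1 + \<epsilon>) / ((\<epsilon> / (4 + 3 * \<epsilon>))\<^sup>2 * dmax s) * L" by (auto simp: p_eq)
      then have "real (card D) * p \<le> arc_mean"
        using mult_right_mono[OF cardD, of p] p unfolding mean by simp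
      then have "measure_pmf.prob (binomial_pmf (card D) p) {k. 3 * arc_mean \<le> real k} \<le> exp (- arc_mean)"
        using p by (intro binomial_large_deviation) auto
      moreover have "measure_pmf.prob N {\<omega>. 3 * arc_mean < real (card {a\<in>D. \<omega> a})}
          \<le> measure_pmf.prob N {\<omega>. 3 * arc_mean \<le> real (card {a\<in>D. \<omega> a})}"
        by (intro measure_pmf.finite_measure_mono) auto
      moreover have "measure_pmf.prob N {\<omega>. 3 * arc_mean \<le> real (card {a\<in>D. \<omega> a})}
          = measure_pmf.prob (binomial_pmf (card D) p) {k. 3 * arc_mean \<le> real k}"
        unfolding N_def using p finD prob_card_Pi_bernoulli[of D D p "\<lambda>k. 3 * arc_mean \<le> real k"] by simp
      moreover have "exp (- arc_mean) \<le> 1 * exp (- L)" using L_le by simp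
      moreover have "1 * exp (- L) \<le> real n * exp (- L)"
        using L by (intro mult_right_mono) auto
      ultimately have "measure_pmf.prob N {\<omega>. 3 * arc_mean < real (card {a\<in>D. \<omega> a})} \<le> real n * exp (- L)"
        by linarith
      then show ?thesis using True by (simp add: r_def)
    next
      case False
      \<comment> \<open>For \<open>p = 1\<close> the unclipped formula is at least 1, so even the
        number \<open>n * \<Delta>\<close> of arcs offered is at most
        \<open>arc_mean\<close>.\<close>
      then have "1 \<le> 3 * (1 + \<epsilon>) / ((\<epsilon> / (4 + 3 * \<epsilon>))\<^sup>2 * dmax s) * L" by (auto simp: p_eq)
      then have "real n * dmax s * 1 \<le> arc_mean"
        unfolding mean using dpos by (intro mult_left_mono) auto
      then have "real (card D) \<le> 3 * arc_mean" using cardD L L_le by linarith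
      moreover have "card {a\<in>D. \<omega> a} \<le> card D" for \<omega>
        using finD by (intro card_mono) auto
      ultimately have "real (card {a\<in>D. \<omega> a}) \<le> 3 * arc_mean" for \<omega>
        by (meson of_nat_mono order_trans)
      then have "{\<omega>. 3 * arc_mean < real (card {a\<in>D. \<omega> a})} = {}" by (auto simp: not_less)
      then show ?thesis using False by (simp add: r_def)
    qed
    finally show ?thesis .
  qed
  define bad where "bad A \<longleftrightarrow> \<not> sound \<epsilon> p (dmax s) E (enum s) U (\<lambda>a. a \<in> A) \<or> \<not> real (card A) \<le> 3 * arc_mean"
    for A
  have "map_pmf arcs S = map_pmf (\<lambda>\<omega>. {a. \<omega> a}) N"
  proof -
    have "distinct (map (\<lambda>(u, v). {u, v}) (es k))" using stream[of k] by (simp add: edge_stream_def)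
    moreover have "u \<noteq> v" if "(u, v) \<in> set (es k)" for u v
    proof (rule simple_graph_edge_neq[OF graph])
      show "{u, v} \<in> E" using stream[of k] that by (force simp: edge_stream_def)
    qed
    ultimately show ?thesis
      unfolding S_def by (subst scan_arcs)
        (auto simp: track_peak_def edge_stream_arcs[OF stream] N_def D_def U_def)
  qed
  then have "measure_pmf.prob S {t. bad (arcs t)} = measure_pmf.prob N {\<omega>. bad {a. \<omega> a}}"
    using measure_map_pmf[of arcs S "Collect bad"] measure_map_pmf[of "\<lambda>\<omega>. {a. \<omega> a}" N "Collect bad"]
    by (simp add: vimage_def)
  also have "{\<omega>. bad {a. \<omega> a}} = {\<omega>. \<not> sound \<epsilon> p (dmax s) E (enum s) U \<omega>} \<union>
      {\<omega>. \<not> real (card {a. \<omega> a}) \<le> 3 * arc_mean}"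
    by (auto simp: bad_def)
  also have "measure_pmf.prob N \<dots> \<le> real n * r + real n * r"
    using unsound many by (intro order_trans[OF measure_Un_le] add_mono) auto
  also have "\<dots> \<le> fail_prob k"
  proof (cases "p < 1")
    case True
    then have "real (Suc k) \<le> T" using sampling_round[OF T, of k] by (simp add: p_def dmax)
    then show ?thesis using True exp_minus_L[OF T] T by (simp add: r_def fail_prob_def field_simps)
  next
    case False
    then show ?thesis using T delta by (simp add: r_def fail_prob_def)
  qed
  finally have bad: "measure_pmf.prob S {t. bad (arcs t)} \<le> fail_prob k" .
  have "1 - fail_prob k \<le> measure_pmf.prob S (UNIV - {t. bad (arcs t)})"
    using bad by (subst measure_pmf.prob_compl[simplified]) auto
  also have "\<dots> \<le> measure_pmf.prob S {t. good_inv (Suc k) (post \<epsilon> p (enum s) t)}"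
  proof (rule measure_pmf.finite_measure_mono_AE)
    have "good_inv (Suc k) (post \<epsilon> p (enum s) t)" if "t \<in> set_pmf S" "\<not> bad (arcs t)" for t
      using that inv dpos by (intro post_good_inv) (auto simp: S_def bad_def U_def)
    then show "AE t in S. t \<in> UNIV - {t. bad (arcs t)} \<longrightarrow> t \<in> {t. good_inv (Suc k) (post \<epsilon> p (enum s) t)}"
      by (simp add: AE_measure_pmf_iff)
  qed simp
  also have "\<dots> = measure_pmf.prob (iteration \<epsilon> \<delta> n es enum s) {s'. good_inv (Suc k) s'}"
    by (simp add: iteration_post k S_def p_def vimage_def)
  finally show ?thesis .
qed

section \<open>Termination and success probability of the whole run\<close>

lemma rounds_enough: "(real n - 1) / b ^ (rounds - 1) < 1"
proof -
  have "real n \<le> b ^ (rounds - 1)"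
  proof (cases "n = 0")
    case False
    have "real n = b powr T" using False eps by (simp add: T_def)
    also have "\<dots> \<le> b powr real (nat \<lceil>T\<rceil>)" using eps by (intro powr_mono) (auto intro: real_nat_ceiling_ge)
    also have "\<dots> = b ^ (rounds - 1)" using eps by (simp add: powr_realpow rounds_def)
    finally show ?thesis .
  qed (use eps in simp)
  moreover have "0 < b ^ (rounds - 1)" using eps by simp
  ultimately show ?thesis by (subst pos_divide_less_eq) auto
qed

lemma base_inv_final: "base_inv rounds s \<Longrightarrow> alive s = {}"
  using rounds_enough by (auto simp: base_inv_def rounds_def)

lemma initial_base_inv: "base_inv 0 (initial_state V)"
  by (simp add: base_inv_def initial_state_def track_peak_def)

lemma iteration_base_inv:
  assumes "base_inv k s"
  shows "measure_pmf.prob (iteration \<epsilon> \<delta> n es enum s) {s'. base_inv (Suc k) s'} = 1"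
proof (subst measure_pmf.prob_eq_1)
  have k: "passes s = k" using assms by (simp add: base_inv_def)
  show "AE s' in iteration \<epsilon> \<delta> n es enum s. s' \<in> {s'. base_inv (Suc k) s'}"
    using post_base_inv[OF assms] by (auto simp: AE_measure_pmf_iff iteration_post k)
qed simp

text \<open>Here \<open>n < 1 + \<epsilon> / 2\<close>, so a nonzero degree is at least 1 and is
  compared with degrees at most \<open>n\<close>. Only the sure invariant enters, with failure
  probability 0 in each round; it holds for any value of \<open>p\<close>.\<close>

lemma dd_algorithm_small:
  assumes "T < 1"
  shows "measure (measure_spmf (dd_algorithm \<epsilon> \<delta> V es enum))
    {s. distinct (out s) \<and> dd_order (1 / (1 + \<epsilon>)) V E (list_order (out s))} = 1"
proof -
  have n: "real n < b"
  proof (cases "n = 0")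
    case False
    then show ?thesis using assms eps by (simp add: T_def log_less_iff)
  qed (use eps in simp)
  have prefix: "dd_prefix (1 / (1 + \<epsilon>)) V E xs" for xs
    unfolding dd_prefix_def dd_at_def
  proof (intro allI impI ballI)
    fix i u
    let ?H = "V - set (take i xs)"
    assume ne: "nbrs E ?H (xs ! i) \<noteq> {}" and "u \<in> ?H"
    have "card (nbrs E ?H u) \<le> n" using finite_V by (intro card_mono) (auto simp: nbrs_def)
    then have "1 / (1 + \<epsilon>) * real (card (nbrs E ?H u)) \<le> 1" using n eps by (simp add: field_simps)
    also have "1 \<le> real (card (nbrs E ?H (xs ! i)))"
      using ne finite_V by (simp add: Suc_le_eq card_gt_0_iff finite_nbrs)
    finally show "1 / (1 + \<epsilon>) * real (card (nbrs E ?H u)) \<le> real (card (nbrs E ?H (xs ! i)))" .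
  qed
  have "1 - sum (\<lambda>_. 0) {0..<rounds} \<le> measure (measure_spmf (while_loop \<epsilon> \<delta> n es enum (initial_state V)))
    {s. distinct (out s) \<and> dd_order (1 / (1 + \<epsilon>)) V E (list_order (out s))}"
  proof (rule while_loop_prob[where I = base_inv])
    show "s \<in> {s. distinct (out s) \<and> dd_order (1 / (1 + \<epsilon>)) V E (list_order (out s))}"
      if "base_inv k s" "alive s = {}" for k s
      using that prefix dd_order_of_prefix[OF graph, of "out s" "1 / (1 + \<epsilon>)"] by (auto simp: base_inv_def)
  qed (use iteration_base_inv base_inv_final initial_base_inv in auto)
  then show ?thesis
    unfolding dd_algorithm_def
    by (intro antisym) (auto simp: measure_measure_spmf_conv_measure_pmf)
qed

lemma dd_algorithm_large:
  assumes "1 \<le> T"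
  shows "1 - \<delta> \<le> measure (measure_spmf (dd_algorithm \<epsilon> \<delta> V es enum))
    {s. distinct (out s) \<and> dd_order (1 / (1 + \<epsilon>)) V E (list_order (out s)) \<and>
        passes s \<le> rounds \<and> real (peak s) \<le> peak_bound}"
proof -
  note L = one_le_T_bounds[OF assms]
  have mean: "0 \<le> arc_mean" using L eps by (simp add: arc_mean_def)
  have init: "good_inv 0 (initial_state V)"
  proof -
    have "real (card (nbrs E V v)) \<le> real n - 1" if "v \<in> V" for v
      using card_nbrs_less[OF graph finite_V that] by linarith
    then show ?thesis
      using initial_base_inv mean
      by (auto simp: good_inv_def initial_state_def track_peak_def words_def peak_bound_def)
  qed
  have "1 - \<delta> \<le> 1 - sum fail_prob {0..<rounds}"
    using sum_fail_prob[OF assms, of rounds] by (simp add: lessThan_atLeast0)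
  also have "\<dots> \<le> measure (measure_spmf (while_loop \<epsilon> \<delta> n es enum (initial_state V)))
    {s. distinct (out s) \<and> dd_order (1 / (1 + \<epsilon>)) V E (list_order (out s)) \<and>
        passes s \<le> rounds \<and> real (peak s) \<le> peak_bound}"
  proof (rule while_loop_prob[where I = good_inv])
    show "s \<in> {s. distinct (out s) \<and> dd_order (1 / (1 + \<epsilon>)) V E (list_order (out s)) \<and>
        passes s \<le> rounds \<and> real (peak s) \<le> peak_bound}"
      if "k \<le> rounds" "good_inv k s" "alive s = {}" for k s
      using that dd_order_of_prefix[OF graph, of "out s" "1 / (1 + \<epsilon>)"]
      by (auto simp: base_inv_def good_inv_def)
    show "0 \<le> fail_prob k" for k using assms delta by (simp add: fail_prob_def)
    show "sum fail_prob {..<rounds} \<le> 1" using sum_fail_prob[OF assms, of rounds] delta by simp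
  qed (use round_prob[OF assms] base_inv_final init in \<open>auto simp: good_inv_def\<close>)
  finally show ?thesis by (simp add: dd_algorithm_def)
qed

section \<open>Resources\<close>

text \<open>Comes from \<open>ln b \<ge> 1 - 1 / b = \<epsilon> / (2 + \<epsilon>)\<close>.\<close>

lemma T_le:
  assumes "2 \<le> n"
  shows "T \<le> (2 + \<epsilon>) / \<epsilon> * ln (real n)"
proof -
  have "\<epsilon> / (2 + \<epsilon>) \<le> ln b"
    using ln_le_minus_one[of "1 / b"] eps by (simp add: ln_div field_simps)
  moreover have "0 < \<epsilon> / (2 + \<epsilon>)" "0 \<le> ln (real n)" using eps assms by auto
  ultimately have "ln (real n) / ln b \<le> ln (real n) / (\<epsilon> / (2 + \<epsilon>))"
    by (intro divide_left_mono mult_pos_pos) auto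
  then show ?thesis by (simp add: T_def log_def mult.commute)
qed

text \<open>\<open>1 \<le> n / 2\<close> and \<open>\<epsilon> / 2 \<le> n / 4\<close> give
  \<open>b \<le> n\<close>; this is the purpose of the condition
  \<open>2 * \<epsilon> \<le> n\<close> in the resource bounds.\<close>

lemma one_le_T:
  assumes "2 \<le> n" "2 * \<epsilon> \<le> real n"
  shows "1 \<le> T"
  unfolding T_def using assms eps by (subst le_log_iff) auto

lemma half_le_ln: 
  fixes x :: real
  assumes "2 \<le> x"
  shows "1 / 2 \<le> ln x"
proof -
  have "1 - 1 / x \<le> ln x" using ln_le_minus_one[of "1 / x"] assms by (simp add: ln_div)
  moreover have "1 / x \<le> 1 / 2" using assms by simp
  ultimately show ?thesis by linarith
qed

lemma rounds_le:
  assumes "\<epsilon> \<le> \<epsilon>0" "2 \<le> n" "2 * \<epsilon> \<le> real n"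
  shows "real rounds \<le> (2 + 5 * \<epsilon>0) * (ln (real n) / \<epsilon>)"
proof -
  have ln: "1 / 2 \<le> ln (real n)" using assms by (intro half_le_ln) auto
  have "real rounds \<le> T + 2" using one_le_T[OF assms(2,3)] unfolding rounds_def by linarith
  \<comment> \<open>The additive 2 is absorbed into \<open>4 * ln n\<close>; the coefficients
    \<open>2 + \<epsilon>\<close> and \<open>4 * \<epsilon>\<close> make up
    \<open>2 + 5 * \<epsilon>\<close>.\<close>
  also have "\<dots> \<le> (2 + \<epsilon>) / \<epsilon> * ln (real n) + 4 * \<epsilon> * (ln (real n) / \<epsilon>)"
    using T_le[OF assms(2)] ln eps by simp
  also have "\<dots> = (2 + 5 * \<epsilon>) * (ln (real n) / \<epsilon>)"
    using eps by (simp add: field_simps)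
  also have "\<dots> \<le> (2 + 5 * \<epsilon>0) * (ln (real n) / \<epsilon>)"
    using assms ln eps by (intro mult_right_mono) auto
  finally show ?thesis .
qed

text \<open>Everything is expressed through \<open>Q = n / (\<epsilon> * \<delta>) \<ge> 2\<close>.
  The argument of the logarithm in \<open>L\<close> is at most \<open>c * Q\<^sup>2\<close>, so
  \<open>L\<close> is at most a constant times \<open>ln Q\<close>.\<close>

lemma peak_bound_le:
  assumes "\<epsilon> \<le> \<epsilon>0" "2 \<le> n" "2 * \<epsilon> \<le> real n"
  defines "c \<equiv> 2 * (2 + \<epsilon>0) * (1 + \<epsilon>0)"
  shows "peak_bound \<le> (20 * \<epsilon>0\<^sup>2 + 18 * (1 + \<epsilon>0) * (4 + 3 * \<epsilon>0)\<^sup>2 * (2 + 2 * ln c)) *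
    (real n / \<epsilon>\<^sup>2 * ln (real n / (\<epsilon> * \<delta>)))"
proof -
  define Q where "Q = real n / (\<epsilon> * \<delta>)"
  define X where "X = real n / \<epsilon>\<^sup>2 * ln Q"
  note T = one_le_T[OF assms(2,3)]
  have e0: "0 < \<epsilon>0" using assms eps by linarith
  have Q: "real n / \<epsilon> \<le> Q" "2 \<le> real n / \<epsilon>"
    using eps delta assms by (auto simp: Q_def field_simps mult_left_le)
  then have Q2: "2 \<le> Q" by linarith
  note lnQ = half_le_ln[OF Q2]
  have c: "1 \<le> c"
  proof -
    have "1 * 1 \<le> (2 * (2 + \<epsilon>0)) * (1 + \<epsilon>0)" using e0 by (intro mult_mono) auto
    then show ?thesis by (simp add: c_def)
  qed
  have "2 * real n * T / \<delta> \<le> c * (Q * Q)"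
  proof -
    have "T \<le> (2 + \<epsilon>) / \<epsilon> * real n"
      using T_le[OF assms(2)] ln_le_minus_one[of "real n"] assms(2) eps
      by (intro order_trans[OF T_le[OF assms(2)]] mult_left_mono) auto
    then have "2 * real n * T / \<delta> \<le> 2 * real n * ((2 + \<epsilon>) / \<epsilon> * real n) / \<delta>"
      using delta by (intro divide_right_mono mult_left_mono) auto
    also have "\<dots> = 2 * (2 + \<epsilon>) * (real n * Q)" by (simp add: Q_def)
    also have "\<dots> \<le> 2 * (2 + \<epsilon>0) * ((1 + \<epsilon>0) * Q * Q)"
    proof -
      \<comment> \<open>The factor \<open>1 + \<epsilon>0\<close>, and not
        \<open>\<epsilon>0\<close>, keeps \<open>c \<ge> 1\<close>; so \<open>ln c\<close> is
        nonnegative and can be absorbed using \<open>ln Q \<ge> 1 / 2\<close>.\<close>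
      have "real n = \<epsilon> * (real n / \<epsilon>)" using eps by simp
      also have "\<dots> \<le> (1 + \<epsilon>0) * Q" using Q eps assms by (intro mult_mono) auto
      finally show ?thesis using Q2 assms eps e0 by (intro mult_mono mult_right_mono) auto
    qed
    finally show ?thesis by (simp add: c_def mult_ac)
  qed
  then have "L \<le> ln (c * (Q * Q))"
    unfolding L_def using T assms(2) delta by (intro ln_mono) auto
  also have "\<dots> = ln c + 2 * ln Q" using c Q2 by (simp add: ln_mult)
  also have "\<dots> \<le> (2 + 2 * ln c) * ln Q"
  proof -
    have "ln c * 1 \<le> ln c * (2 * ln Q)" using c lnQ by (intro mult_left_mono) auto
    then show ?thesis by (simp add: algebra_simps)
  qed
  finally have L: "L \<le> (2 + 2 * ln c) * ln Q" .
  have "arc_mean = 3 * ((1 + \<epsilon>) * (4 + 3 * \<epsilon>)\<^sup>2) * (real n / \<epsilon>\<^sup>2 * L)"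
    by (simp add: arc_mean_def power_divide mult_ac)
  also have "\<dots> \<le> 3 * ((1 + \<epsilon>0) * (4 + 3 * \<epsilon>0)\<^sup>2) * (real n / \<epsilon>\<^sup>2 * ((2 + 2 * ln c) * ln Q))"
    using L one_le_T_bounds[OF T] eps assms(1) e0 by (intro mult_mono power_mono) auto
  also have "\<dots> = 3 * ((1 + \<epsilon>0) * (4 + 3 * \<epsilon>0)\<^sup>2 * (2 + 2 * ln c) * X)"
    by (simp only: X_def mult_ac times_divide_eq_right times_divide_eq_left)
  finally have mean: "6 * arc_mean \<le> 18 * (1 + \<epsilon>0) * (4 + 3 * \<epsilon>0)\<^sup>2 * (2 + 2 * ln c) * X"
    by linarith
  \<comment> \<open>For \<open>n \<ge> 2\<close>, \<open>3 * n + 13 \<le> 10 * n\<close>; the 20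
    arises from \<open>ln Q \<ge> 1 / 2\<close>.\<close>
  have "3 * real n + 13 \<le> 20 * \<epsilon>\<^sup>2 * (real n / \<epsilon>\<^sup>2 * (1 / 2))" using assms(2) eps by simp
  also have "\<dots> \<le> 20 * \<epsilon>0\<^sup>2 * X"
    unfolding X_def using lnQ eps assms(1) by (intro mult_mono power_mono) auto
  finally have "3 * real n + 13 \<le> 20 * \<epsilon>0\<^sup>2 * X" .
  with mean have "peak_bound \<le> (20 * \<epsilon>0\<^sup>2 + 18 * (1 + \<epsilon>0) * (4 + 3 * \<epsilon>0)\<^sup>2 * (2 + 2 * ln c)) * X"
    by (simp add: peak_bound_def distrib_right)
  then show ?thesis by (simp add: X_def Q_def)
qed

lemma dd_algorithm_correct:
  fixes \<epsilon>0 :: real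
  defines "c \<equiv> 2 * (2 + \<epsilon>0) * (1 + \<epsilon>0)"
  assumes "2 + 5 * \<epsilon>0 \<le> C"
    "20 * \<epsilon>0\<^sup>2 + 18 * (1 + \<epsilon>0) * (4 + 3 * \<epsilon>0)\<^sup>2 * (2 + 2 * ln c) \<le> C"
  shows "measure (measure_spmf (dd_algorithm \<epsilon> \<delta> V es enum))
      {s. distinct (out s) \<and> dd_order (1 / (1 + \<epsilon>)) V E (list_order (out s)) \<and>
          (\<epsilon> \<le> \<epsilon>0 \<longrightarrow> 2 \<le> card V \<longrightarrow> 2 * \<epsilon> \<le> real (card V) \<longrightarrow>
             real (passes s) \<le> C * (ln (real (card V)) / \<epsilon>) \<and>
             real (peak s) \<le> C * (real (card V) / \<epsilon>\<^sup>2 * ln (real (card V) / (\<epsilon> * \<delta>))))}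
    \<ge> 1 - \<delta>" (is "measure ?M ?G \<ge> _")
proof (cases "1 \<le> T")
  case True
  have "1 - \<delta> \<le> measure ?M {s. distinct (out s) \<and> dd_order (1 / (1 + \<epsilon>)) V E (list_order (out s)) \<and>
        passes s \<le> rounds \<and> real (peak s) \<le> peak_bound}"
    using dd_algorithm_large[OF True] .
  also have "\<dots> \<le> measure ?M ?G"
  proof (rule measure_spmf.finite_measure_mono)
    have "real (passes s) \<le> C * (ln (real n) / \<epsilon>) \<and> real (peak s) \<le> C * (real n / \<epsilon>\<^sup>2 * ln (real n / (\<epsilon> * \<delta>)))"
      if s: "passes s \<le> rounds" "real (peak s) \<le> peak_bound"
        and small: "\<epsilon> \<le> \<epsilon>0" "2 \<le> n" "2 * \<epsilon> \<le> real n" for s :: "'a state"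
    proof
      have "real (passes s) \<le> (2 + 5 * \<epsilon>0) * (ln (real n) / \<epsilon>)"
        using rounds_le[OF small] s(1) by linarith
      also have "\<dots> \<le> C * (ln (real n) / \<epsilon>)"
        using assms(2) eps small(2) by (intro mult_right_mono) auto
      finally show "real (passes s) \<le> C * (ln (real n) / \<epsilon>)" .
      have "\<epsilon> * \<delta> \<le> real n"
        using small(2,3) eps delta mult_left_mono[of \<delta> 1 \<epsilon>] by linarith
      then have "0 \<le> real n / \<epsilon>\<^sup>2 * ln (real n / (\<epsilon> * \<delta>))"
        using eps delta by (intro mult_nonneg_nonneg ln_ge_zero) auto
      then have "(20 * \<epsilon>0\<^sup>2 + 18 * (1 + \<epsilon>0) * (4 + 3 * \<epsilon>0)\<^sup>2 * (2 + 2 * ln c)) *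
          (real n / \<epsilon>\<^sup>2 * ln (real n / (\<epsilon> * \<delta>))) \<le> C * (real n / \<epsilon>\<^sup>2 * ln (real n / (\<epsilon> * \<delta>)))"
        using assms(3) by (rule mult_right_mono[rotated])
      then show "real (peak s) \<le> C * (real n / \<epsilon>\<^sup>2 * ln (real n / (\<epsilon> * \<delta>)))"
        using peak_bound_le[OF small] s(2) unfolding c_def by linarith
    qed
    then show "{s. distinct (out s) \<and> dd_order (1 / (1 + \<epsilon>)) V E (list_order (out s)) \<and>
        passes s \<le> rounds \<and> real (peak s) \<le> peak_bound} \<subseteq> ?G" by blast
  qed simp
  finally show ?thesis .
next
  case False
  \<comment> \<open>The guards of the resource clause imply \<open>T \<ge> 1\<close>, so for
    \<open>T < 1\<close> that clause holds vacuously.\<close>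
  then have "\<not> (2 \<le> n \<and> 2 * \<epsilon> \<le> real n)" using one_le_T by blast
  then have "?G = {s. distinct (out s) \<and> dd_order (1 / (1 + \<epsilon>)) V E (list_order (out s))}" by blast
  then show ?thesis using dd_algorithm_small False delta by simp
qed

end

text \<open>\<open>C\<close> depends on \<open>\<epsilon>0\<close> alone and is uniform in the
  graph, the streams, the visiting order, \<epsilon> and \<delta>. The O-notation is read for
  \<epsilon> in a bounded range, while the order property is asserted for every positive
  \<epsilon>.\<close>

theorem theorem3:
  fixes \<epsilon>0 :: real
  assumes "\<epsilon>0 > 0"
  shows "\<exists>C>0. \<forall>(V :: 'a set) E es enum \<epsilon> \<delta>.
    simple_graph V E \<longrightarrow> (\<forall>k. edge_stream E (es k)) \<longrightarrow> valid_enum enum \<longrightarrow>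
    0 < \<epsilon> \<longrightarrow> 0 < \<delta> \<longrightarrow> \<delta> < 1 \<longrightarrow>
    measure (measure_spmf (dd_algorithm \<epsilon> \<delta> V es enum))
      {s. distinct (out s) \<and> dd_order (1 / (1 + \<epsilon>)) V E (list_order (out s)) \<and>
          (\<epsilon> \<le> \<epsilon>0 \<longrightarrow> 2 \<le> card V \<longrightarrow> 2 * \<epsilon> \<le> real (card V) \<longrightarrow>
             real (passes s) \<le> C * (ln (real (card V)) / \<epsilon>) \<and>
             real (peak s) \<le> C * (real (card V) / \<epsilon>\<^sup>2 * ln (real (card V) / (\<epsilon> * \<delta>))))}
    \<ge> 1 - \<delta>"
proof -
  define C where "C = max (2 + 5 * \<epsilon>0)
    (20 * \<epsilon>0\<^sup>2 + 18 * (1 + \<epsilon>0) * (4 + 3 * \<epsilon>0)\<^sup>2 * (2 + 2 * ln (2 * (2 + \<epsilon>0) * (1 + \<epsilon>0))))"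
  show ?thesis
  proof (intro exI[of _ C] conjI allI impI)
    show "0 < C" using assms by (simp add: C_def less_max_iff_disj)
    fix V :: "'a set" and E and es :: "nat \<Rightarrow> ('a \<times> 'a) list" and enum :: "'a state \<Rightarrow> 'a list" and \<epsilon> \<delta> :: real
    assume "simple_graph V E" "\<forall>k. edge_stream E (es k)" "valid_enum enum" "0 < \<epsilon>" "0 < \<delta>" "\<delta> < 1"
    then interpret dd_run V E es enum \<epsilon> \<delta> by unfold_locales auto
    show "measure (measure_spmf (dd_algorithm \<epsilon> \<delta> V es enum))
      {s. distinct (out s) \<and> dd_order (1 / (1 + \<epsilon>)) V E (list_order (out s)) \<and>
          (\<epsilon> \<le> \<epsilon>0 \<longrightarrow> 2 \<le> card V \<longrightarrow> 2 * \<epsilon> \<le> real (card V) \<longrightarrow>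
             real (passes s) \<le> C * (ln (real (card V)) / \<epsilon>) \<and>
             real (peak s) \<le> C * (real (card V) / \<epsilon>\<^sup>2 * ln (real (card V) / (\<epsilon> * \<delta>))))}
    \<ge> 1 - \<delta>"
      by (rule dd_algorithm_correct) (simp_all add: C_def)
  qed
qed

end
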